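(* Let $\mathcal P(u)=\big(\frac{P_1(u)}{Q_1(u)},\frac{P_2(u)}{Q_2(u)}\big)$ be a linear differential rational parametrization with $m_i=\mathrm{ord}\big(\frac{P_i}{Q_i}\big)\ge 0$ for $i=1,2$. If $\mathcal P(u)$ is proper, then the differential resultant $$R(x,y):=\delta\text{-}\mathrm{Res}_u\big(xQ_1(u)-P_1(u),\,yQ_2(u)-P_2(u)\big)\in\mathcal F\{x,y\}$$ is nonzero. Furthermore, $\mathrm{ord}_xR=m_2$, $\mathrm{ord}_yR=m_1$, and $R$ is linear in $x^{(m_2)}$ and in $y^{(m_1)}$.
   Context: $\mathcal F$ is an ordinary differential field of characteristic $0$ with derivation $\delta$, and $\mathcal E$ is a fixed universal differential extension field of $\mathcal F$; $x,y$ are differential indeterminates over $\mathcal E$, and $u\in\mathcal E$ is differentially transcendental over $\mathcal F$. $\mathcal F\{S\}$ and $\mathcal F\langle S\rangle$ denote the differential ring and differential field generated by $S$ over $\mathcal F$; $w^{(k)}=\delta^k(w)$. Orders: for a differential polynomial $f$ and an indeterminate $w$, $\mathrm{ord}_w f$ is the largest $k$ such that $w^{(k)}$ effectively appears in $f$, and $-\infty$ if no derivative of $w$ (including $w$) appears. For $R(u)=P/Q\in\mathcal F\langle u\rangle$ in reduced form ($\gcd(P,Q)=1$), $\mathrm{ord}(R)=\max\{\mathrm{ord}_uP,\mathrm{ord}_uQ\}$. A linear differential rational parametrization is a pair $\mathcal P(u)=\big(\frac{P_1(u)}{Q_1(u)},\frac{P_2(u)}{Q_2(u)}\big)\in\mathcal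 F\langle u\rangle^2\setminus\mathcal F^2$ such that, for $i=1,2$, $P_i,Q_i\in\mathcal F\{u\}$ have degree at most $1$ and $\gcd(P_i,Q_i)=1$. It is proper if $\mathcal F\langle \frac{P_1(u)}{Q_1(u)},\frac{P_2(u)}{Q_2(u)}\rangle=\mathcal F\langle u\rangle$. Differential resultant: let $f_1,f_2\in\mathbb D\{u\}$ be linear differential polynomials (degree $1$ in $u$ and its derivatives, possibly with a constant term) of orders $m_1,m_2$ in $u$ over a differential domain $\mathbb D$ (here $\mathbb D=\mathcal F\{x,y\}$). Let $M$ be the $(m_1+m_2+2)\times(m_1+m_2+2)$ matrix whose $k$-th row is the coefficient vector of the $k$-th element of the list $f_1^{(m_2)},f_1^{(m_2-1)},\dots,f_1,f_2^{(m_1)},f_2^{(m_1-1)},\dots,f_2$ with respect to $u^{(m_1+m_2)}>u^{(m_1+m_2-1)}>\cdots>u>1$. Then $\delta\text{-}\mathrm{Res}_u(f_1,f_2):=\det(M)$. *)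

theory Defs
  imports
    "Jordan_Normal_Form.Determinant"
    "HOL-Library.Poly_Mapping"
    "HOL-Library.Extended"
    "HOL-Algebra.Subrings"
begin

section \<open>Differential fields\<close>

definition derivation :: "('a::comm_ring_1 \<Rightarrow> 'a) \<Rightarrow> bool" where
  "derivation d \<longleftrightarrow>
     (\<forall>a b. d (a + b) = d a + d b) \<and> (\<forall>a b. d (a * b) = d a * b + a * d b)"

text \<open>
  The base field \<open>F\<close> is a type of its own, embedded into the extension \<open>E\<close> by \<open>\<iota>\<close>; the subfield
  \<open>F\<close> of \<open>E\<close> is \<open>range \<iota>\<close>.
\<close>

definition differential_extension ::
  "('f::field \<Rightarrow> 'e::field) \<Rightarrow> ('f \<Rightarrow> 'f) \<Rightarrow> ('e \<Rightarrow> 'e) \<Rightarrow> bool" where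
  "differential_extension \<iota> dF dE \<longleftrightarrow>
     derivation dF \<and> derivation dE \<and> field_hom \<iota> \<and> (\<forall>a. \<iota> (dF a) = dE (\<iota> a))"

definition differential_subfield :: "('e::field \<Rightarrow> 'e) \<Rightarrow> 'e set \<Rightarrow> bool" where
  "differential_subfield dE K \<longleftrightarrow>
     0 \<in> K \<and> 1 \<in> K \<and>
     (\<forall>a\<in>K. \<forall>b\<in>K. a + b \<in> K \<and> a * b \<in> K) \<and>
     (\<forall>a\<in>K. - a \<in> K \<and> inverse a \<in> K \<and> dE a \<in> K)"

text \<open>\<open>F\<langle>S\<rangle>\<close>\<close>

definition diff_field_gen ::
  "('f::field \<Rightarrow> 'e::field) \<Rightarrow> ('e \<Rightarrow> 'e) \<Rightarrow> 'e set \<Rightarrow> 'e set" where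
  "diff_field_gen \<iota> dE S = \<Inter>{K. differential_subfield dE K \<and> range \<iota> \<union> S \<subseteq> K}"

section \<open>Universal extensions\<close>

text \<open>
  Kolchin's definition: every finitely generated differential extension \<open>G\<close> of every finitely
  generated differential extension \<open>F1 \<subseteq> E\<close> of \<open>F\<close> embeds into \<open>E\<close> over \<open>F1\<close>.  It is enough to
  let \<open>G\<close> range over the differential fields carried by subsets of the type of \<open>E\<close>: in
  characteristic 0, \<open>F1\<close> is infinite and a finitely generated extension of it has the same
  cardinality, so it has an isomorphic copy of this form.
\<close>

definition ring_of_type :: "'e::field ring" where
  "ring_of_type = \<lparr>carrier = UNIV, mult = (*), one = 1, zero = 0, add = (+)\<rparr>"

definition differential_field_on :: "'b ring \<Rightarrow> ('b \<Rightarrow> 'b) \<Rightarrow> bool" where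
  "differential_field_on G D \<longleftrightarrow>
     Ring.field G \<and>
     D \<in> carrier G \<rightarrow> carrier G \<and>
     (\<forall>a\<in>carrier G. \<forall>b\<in>carrier G.
        D (a \<oplus>\<^bsub>G\<^esub> b) = D a \<oplus>\<^bsub>G\<^esub> D b \<and>
        D (a \<otimes>\<^bsub>G\<^esub> b) = (D a \<otimes>\<^bsub>G\<^esub> b) \<oplus>\<^bsub>G\<^esub> (a \<otimes>\<^bsub>G\<^esub> D b))"

text \<open>\<open>j\<close> embeds the differential field \<open>(G, D)\<close> into \<open>(H, D')\<close>; injectivity is automatic.\<close>

definition diff_embedding ::
  "'b ring \<Rightarrow> ('b \<Rightarrow> 'b) \<Rightarrow> 'c ring \<Rightarrow> ('c \<Rightarrow> 'c) \<Rightarrow> ('b \<Rightarrow> 'c) \<Rightarrow> bool" where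
  "diff_embedding G D H D' j \<longleftrightarrow>
     j \<in> Ring.ring_hom G H \<and> (\<forall>a\<in>carrier G. j (D a) = D' (j a))"

definition diff_generated_by :: "'b ring \<Rightarrow> ('b \<Rightarrow> 'b) \<Rightarrow> 'b set \<Rightarrow> bool" where
  "diff_generated_by G D S \<longleftrightarrow>
     S \<subseteq> carrier G \<and> (\<forall>K. subfield K G \<and> D ` K \<subseteq> K \<and> S \<subseteq> K \<longrightarrow> K = carrier G)"

definition universal_extension ::
  "('f::field \<Rightarrow> 'e::field_char_0) \<Rightarrow> ('f \<Rightarrow> 'f) \<Rightarrow> ('e \<Rightarrow> 'e) \<Rightarrow> bool" where
  "universal_extension \<iota> dF dE \<longleftrightarrow>
     differential_extension \<iota> dF dE \<and>
     (\<forall>S (G :: 'e ring) D i T.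
        let E = ring_of_type; F1 = diff_field_gen \<iota> dE S in
        finite S \<and> differential_field_on G D \<and>
        diff_embedding (E\<lparr>carrier := F1\<rparr>) dE G D i \<and>
        finite T \<and> diff_generated_by G D (i ` F1 \<union> T) \<longrightarrow>
        (\<exists>j. diff_embedding G D E dE j \<and> (\<forall>a\<in>F1. j (i a) = a)))"

section \<open>Differential polynomials\<close>

text \<open>
  \<open>('i, 'a) dpoly\<close> is the ring of differential polynomials over \<open>'a\<close> in indeterminates indexed by
  \<open>'i\<close>: ordinary polynomials in the variables \<open>(i, k)\<close>, where \<open>(i, k)\<close> is the \<open>k\<close>-th derivative
  of the indeterminate \<open>i\<close>.  For a single indeterminate, \<open>'i = unit\<close>.
\<close>

type_synonym 'i dmonom = "('i \<times> nat) \<Rightarrow>\<^sub>0 nat"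
type_synonym ('i, 'a) dpoly = "'i dmonom \<Rightarrow>\<^sub>0 'a"

abbreviation dconst :: "'a::zero \<Rightarrow> ('i, 'a) dpoly" where
  "dconst c \<equiv> Poly_Mapping.single 0 c"

definition dvar :: "'i \<Rightarrow> nat \<Rightarrow> ('i, 'a::zero_neq_one) dpoly" where
  "dvar i k = Poly_Mapping.single (Poly_Mapping.single (i, k) 1) 1"

text \<open>
  The derivation that extends \<open>d\<close> on the coefficients and maps the variable \<open>(i, k)\<close> to
  \<open>(i, Suc k)\<close>: a term \<open>c m\<close> goes to \<open>d c m\<close> plus the sum over the variables \<open>(i, k)\<close> of \<open>m\<close> of
  \<open>c (\<partial>m/\<partial>(i, k)) (i, Suc k)\<close>.
\<close>

definition dterm_deriv :: "('a::comm_ring_1 \<Rightarrow> 'a) \<Rightarrow> 'i dmonom \<Rightarrow> 'a \<Rightarrow> ('i, 'a) dpoly" where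
  "dterm_deriv d m c =
     Poly_Mapping.single m (d c) +
     (\<Sum>(i, k) \<in> Poly_Mapping.keys m.
        Poly_Mapping.single
          (m - Poly_Mapping.single (i, k) 1 + Poly_Mapping.single (i, Suc k) 1)
          (of_nat (Poly_Mapping.lookup m (i, k)) * c))"

definition dpoly_deriv :: "('a::comm_ring_1 \<Rightarrow> 'a) \<Rightarrow> ('i, 'a) dpoly \<Rightarrow> ('i, 'a) dpoly" where
  "dpoly_deriv d f = (\<Sum>m \<in> Poly_Mapping.keys f. dterm_deriv d m (Poly_Mapping.lookup f m))"

lemma derivation_zero: "derivation d \<Longrightarrow> d 0 = 0"
  unfolding derivation_def by (metis add_cancel_right_right)

lemma dterm_deriv_add:
  assumes "derivation d"
  shows "dterm_deriv d m (a + b) = dterm_deriv d m a + dterm_deriv d m b"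
  using assms
  by (simp add: dterm_deriv_def derivation_def single_add distrib_left sum.distrib case_prod_unfold)

lemma dterm_deriv_zero: "derivation d \<Longrightarrow> dterm_deriv d m 0 = 0"
  by (simp add: dterm_deriv_def derivation_zero)

lemma dpoly_deriv_superset:
  assumes "derivation d" "finite A" "Poly_Mapping.keys f \<subseteq> A"
  shows "dpoly_deriv d f = (\<Sum>m\<in>A. dterm_deriv d m (Poly_Mapping.lookup f m))"
  unfolding dpoly_deriv_def
  by (rule sum.mono_neutral_left) (use assms in \<open>auto simp: dterm_deriv_zero in_keys_iff\<close>)

lemma dpoly_deriv_single:
  "derivation d \<Longrightarrow> dpoly_deriv d (Poly_Mapping.single m c) = dterm_deriv d m c"
  by (subst dpoly_deriv_superset[where A = "{m}"]) auto

lemma dpoly_deriv_add: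
  assumes "derivation d"
  shows "dpoly_deriv d (f + g) = dpoly_deriv d f + dpoly_deriv d g"
proof -
  let ?A = "Poly_Mapping.keys f \<union> Poly_Mapping.keys g"
  have "dpoly_deriv d h = (\<Sum>m\<in>?A. dterm_deriv d m (Poly_Mapping.lookup h m))"
    if "Poly_Mapping.keys h \<subseteq> ?A" for h
    using that assms by (intro dpoly_deriv_superset) auto
  then show ?thesis
    using Poly_Mapping.keys_add[of f g]
    by (simp add: lookup_add dterm_deriv_add[OF assms] sum.distrib)
qed

lemma dpoly_deriv_sum:
  "derivation d \<Longrightarrow> dpoly_deriv d (\<Sum>x\<in>A. h x) = (\<Sum>x\<in>A. dpoly_deriv d (h x))"
  by (induction A rule: infinite_finite_induct)
     (auto simp: dpoly_deriv_add, auto simp: dpoly_deriv_def)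

lemma dterm_deriv_superset:
  assumes "finite V" "Poly_Mapping.keys m \<subseteq> V"
  shows "dterm_deriv d m c = Poly_Mapping.single m (d c) +
     (\<Sum>(i, k) \<in> V. Poly_Mapping.single
          (m - Poly_Mapping.single (i, k) 1 + Poly_Mapping.single (i, Suc k) 1)
          (of_nat (Poly_Mapping.lookup m (i, k)) * c))"
  unfolding dterm_deriv_def
  by (intro arg_cong2[where f = "(+)"] refl sum.mono_neutral_left)
     (use assms in \<open>auto simp: in_keys_iff\<close>)

lemma dterm_deriv_mult:
  assumes "derivation d"
  shows "dterm_deriv d (m + n) (a * b) =
    dterm_deriv d m a * Poly_Mapping.single n b + Poly_Mapping.single m a * dterm_deriv d n b"
proof -
  let ?V = "Poly_Mapping.keys m \<union> Poly_Mapping.keys n"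
  let ?s = "\<lambda>i k. Poly_Mapping.single (i, k) (1::nat)"
  have sub: "p + q - ?s i k = p - ?s i k + q" if "Poly_Mapping.lookup p (i, k) \<noteq> 0"
    for p q :: "'b dmonom" and i k
    by (rule poly_mapping_eqI) (use that in \<open>auto simp: lookup_add lookup_minus lookup_single when_def\<close>)
  have t: "Poly_Mapping.single (p + q - ?s i k + ?s i (Suc k)) (of_nat (Poly_Mapping.lookup p (i, k)) * c)
      = Poly_Mapping.single (p - ?s i k + ?s i (Suc k)) (of_nat (Poly_Mapping.lookup p (i, k)) * a')
        * Poly_Mapping.single q b'"
    if "c = a' * b'" for p q :: "'b dmonom" and i k and a' b' c :: 'a
    by (cases "Poly_Mapping.lookup p (i, k) = 0")
       (simp_all add: mult_single sub[simplified] that ac_simps)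
  define S where "S = (\<lambda>p c r. \<Sum>(i, k) \<in> ?V. Poly_Mapping.single (r - ?s i k + ?s i (Suc k))
          (of_nat (Poly_Mapping.lookup p (i, k)) * c) :: ('b, 'a) dpoly)"
  have S_mult: "S p (a' * b') (p + q) = S p a' p * Poly_Mapping.single q b'" for p q a' b'
    unfolding S_def sum_distrib_right case_prod_unfold
    by (intro sum.cong refl t)
  have S: "dterm_deriv d p c = Poly_Mapping.single p (d c) + S p c p"
    if "Poly_Mapping.keys p \<subseteq> ?V" for p c
    unfolding S_def using that by (intro dterm_deriv_superset) auto
  have "dterm_deriv d (m + n) (a * b) =
      Poly_Mapping.single (m + n) (d (a * b)) + S (m + n) (a * b) (m + n)"
    using Poly_Mapping.keys_add[of m n] by (intro S) auto
  also have "S (m + n) (a * b) (m + n) = S m (a * b) (m + n) + S n (b * a) (n + m)"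
    unfolding S_def
    by (simp only: lookup_add of_nat_add distrib_right single_add sum.distrib case_prod_unfold
        add.commute[of n m] mult.commute[of b a])
  also have "d (a * b) = d a * b + a * d b"
    using assms by (simp add: derivation_def)
  also have "Poly_Mapping.single (m + n) (d a * b + a * d b) =
      Poly_Mapping.single m (d a) * Poly_Mapping.single n b +
      Poly_Mapping.single m a * Poly_Mapping.single n (d b)"
    by (simp add: mult_single single_add)
  finally show ?thesis
    unfolding S_mult by (simp add: S algebra_simps)
qed

lemma poly_mapping_as_sum:
  "f = (\<Sum>m\<in>Poly_Mapping.keys f. Poly_Mapping.single m (Poly_Mapping.lookup f m))"
  by (rule poly_mapping_eqI)
     (auto simp: lookup_sum lookup_single when_def in_keys_iff sum.delta)

lemma derivation_dpoly_deriv: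
  assumes "derivation d"
  shows "derivation (dpoly_deriv d)"
proof -
  have "dpoly_deriv d (f * g) = dpoly_deriv d f * g + f * dpoly_deriv d g" for f g :: "('b, 'a) dpoly"
  proof -
    let ?m = "\<lambda>f m. Poly_Mapping.single m (Poly_Mapping.lookup f m)"
    let ?F = "Poly_Mapping.keys f" and ?G = "Poly_Mapping.keys g"
    have "f * g = (\<Sum>m\<in>?F. \<Sum>n\<in>?G. ?m f m * ?m g n)"
      by (subst poly_mapping_as_sum[of f], subst poly_mapping_as_sum[of g]) (rule sum_product)
    then have "dpoly_deriv d (f * g) =
        (\<Sum>m\<in>?F. \<Sum>n\<in>?G. dpoly_deriv d (?m f m) * ?m g n + ?m f m * dpoly_deriv d (?m g n))"
      by (simp add: dpoly_deriv_sum[OF assms] mult_single dpoly_deriv_single[OF assms]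
          dterm_deriv_mult[OF assms])
    also have "\<dots> = dpoly_deriv d (\<Sum>m\<in>?F. ?m f m) * (\<Sum>n\<in>?G. ?m g n)
        + (\<Sum>m\<in>?F. ?m f m) * dpoly_deriv d (\<Sum>n\<in>?G. ?m g n)"
      by (simp add: dpoly_deriv_sum[OF assms] sum.distrib sum_product)
    finally show ?thesis by (simp add: poly_mapping_as_sum[symmetric])
  qed
  then show ?thesis
    by (simp add: derivation_def dpoly_deriv_add[OF assms])
qed

lemma dpoly_deriv_dconst:
  "derivation d \<Longrightarrow> dpoly_deriv d (dconst c) = dconst (d c)"
  by (simp add: dpoly_deriv_single dterm_deriv_def)

lemma dpoly_deriv_dvar:
  assumes "derivation d"
  shows "dpoly_deriv d (dvar i k) = dvar i (Suc k)"
proof -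
  have "d 1 = 0"
    using assms unfolding derivation_def by (metis add_cancel_right_right mult_1_left mult_1_right)
  then show ?thesis
    by (simp add: dvar_def dpoly_deriv_single[OF assms] dterm_deriv_def)
qed

definition occurs :: "'i \<Rightarrow> nat \<Rightarrow> ('i, 'a::zero) dpoly \<Rightarrow> bool" where
  "occurs i k f \<longleftrightarrow> (\<exists>m \<in> Poly_Mapping.keys f. Poly_Mapping.lookup m (i, k) \<noteq> 0)"

definition dord :: "'i \<Rightarrow> ('i, 'a::zero) dpoly \<Rightarrow> nat extended" where
  "dord i f = (if \<exists>k. occurs i k f then Fin (Max {k. occurs i k f}) else -\<infinity>)"

definition total_degree :: "('i, 'a::zero) dpoly \<Rightarrow> nat" where
  "total_degree f =
     Max (insert 0 ((\<lambda>m. \<Sum>v \<in> Poly_Mapping.keys m. Poly_Mapping.lookup m v) ` Poly_Mapping.keys f))"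

definition degree_in :: "'i \<Rightarrow> nat \<Rightarrow> ('i, 'a::zero) dpoly \<Rightarrow> nat" where
  "degree_in i k f = Max (insert 0 ((\<lambda>m. Poly_Mapping.lookup m (i, k)) ` Poly_Mapping.keys f))"

definition gcd_is_one :: "'a::comm_ring_1 \<Rightarrow> 'a \<Rightarrow> bool" where
  "gcd_is_one p q \<longleftrightarrow> (\<forall>h. h dvd p \<and> h dvd q \<longrightarrow> h dvd 1)"

text \<open>Value of a differential polynomial at \<open>u \<in> E\<close>\<close>

definition deval ::
  "('f::field \<Rightarrow> 'e::field) \<Rightarrow> ('e \<Rightarrow> 'e) \<Rightarrow> 'e \<Rightarrow> (unit, 'f) dpoly \<Rightarrow> 'e" where
  "deval \<iota> dE u f =
     (\<Sum>m \<in> Poly_Mapping.keys f. \<iota> (Poly_Mapping.lookup f m) *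
        (\<Prod>k | ((), k) \<in> Poly_Mapping.keys m. (dE ^^ k) u ^ Poly_Mapping.lookup m ((), k)))"

definition diff_transcendental ::
  "('f::field \<Rightarrow> 'e::field) \<Rightarrow> ('e \<Rightarrow> 'e) \<Rightarrow> 'e \<Rightarrow> bool" where
  "diff_transcendental \<iota> dE u \<longleftrightarrow> (\<forall>f :: (unit, 'f) dpoly. deval \<iota> dE u f = 0 \<longrightarrow> f = 0)"

section \<open>Linear differential rational parametrizations\<close>

text \<open>
  As \<open>u\<close> is differentially transcendental, \<open>F{u} \<subseteq> E\<close> is identified with the differential
  polynomials in one indeterminate: \<open>P\<close>, \<open>Q\<close> are polynomials, and \<open>rat_val \<iota> dE u P Q\<close> is the
  element \<open>P(u)/Q(u)\<close> of \<open>E\<close>.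
\<close>

definition rat_val ::
  "('f::field \<Rightarrow> 'e::field) \<Rightarrow> ('e \<Rightarrow> 'e) \<Rightarrow> 'e \<Rightarrow> (unit, 'f) dpoly \<Rightarrow> (unit, 'f) dpoly \<Rightarrow> 'e" where
  "rat_val \<iota> dE u P Q = deval \<iota> dE u P / deval \<iota> dE u Q"

text \<open>Order of \<open>P/Q\<close>, which has to be in reduced form\<close>

definition rat_ord :: "(unit, 'f::zero) dpoly \<Rightarrow> (unit, 'f) dpoly \<Rightarrow> nat extended" where
  "rat_ord P Q = max (dord () P) (dord () Q)"

definition linear_reduced :: "(unit, 'f::field) dpoly \<Rightarrow> (unit, 'f) dpoly \<Rightarrow> bool" where
  "linear_reduced P Q \<longleftrightarrow>
     Q \<noteq> 0 \<and> total_degree P \<le> 1 \<and> total_degree Q \<le> 1 \<and> gcd_is_one P Q"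

definition linear_param ::
  "('f::field \<Rightarrow> 'e::field) \<Rightarrow> ('e \<Rightarrow> 'e) \<Rightarrow> 'e \<Rightarrow>
   (unit, 'f) dpoly \<Rightarrow> (unit, 'f) dpoly \<Rightarrow> (unit, 'f) dpoly \<Rightarrow> (unit, 'f) dpoly \<Rightarrow> bool" where
  "linear_param \<iota> dE u P1 Q1 P2 Q2 \<longleftrightarrow>
     linear_reduced P1 Q1 \<and> linear_reduced P2 Q2 \<and>
     (rat_val \<iota> dE u P1 Q1, rat_val \<iota> dE u P2 Q2) \<notin> range \<iota> \<times> range \<iota>"

definition proper_param ::
  "('f::field \<Rightarrow> 'e::field) \<Rightarrow> ('e \<Rightarrow> 'e) \<Rightarrow> 'e \<Rightarrow>
   (unit, 'f) dpoly \<Rightarrow> (unit, 'f) dpoly \<Rightarrow> (unit, 'f) dpoly \<Rightarrow> (unit, 'f) dpoly \<Rightarrow> bool" where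
  "proper_param \<iota> dE u P1 Q1 P2 Q2 \<longleftrightarrow>
     diff_field_gen \<iota> dE {rat_val \<iota> dE u P1 Q1, rat_val \<iota> dE u P2 Q2} = diff_field_gen \<iota> dE {u}"

section \<open>Differential resultants of linear differential polynomials\<close>

text \<open>
  Here \<open>d\<close> is the derivation of the coefficient domain.  The value \<open>nat_ord f\<close> is only meaningful
  if \<open>u\<close> or one of its derivatives occurs in \<open>f\<close>.
\<close>

definition nat_ord :: "(unit, 'a::zero) dpoly \<Rightarrow> nat" where
  "nat_ord f = (case dord () f of Fin m \<Rightarrow> m | _ \<Rightarrow> 0)"

definition dres_matrix ::
  "('a::comm_ring_1 \<Rightarrow> 'a) \<Rightarrow> (unit, 'a) dpoly \<Rightarrow> (unit, 'a) dpoly \<Rightarrow> 'a mat" where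
  "dres_matrix d f1 f2 =
     (let m1 = nat_ord f1; m2 = nat_ord f2; n = m1 + m2 + 2;
          rows = map (\<lambda>k. (dpoly_deriv d ^^ k) f1) (rev [0..<Suc m2]) @
                 map (\<lambda>k. (dpoly_deriv d ^^ k) f2) (rev [0..<Suc m1]);
          monoms = map (\<lambda>k. Poly_Mapping.single ((), k) 1) (rev [0..<Suc (m1 + m2)]) @ [0]
      in mat n n (\<lambda>(r, c). Poly_Mapping.lookup (rows ! r) (monoms ! c)))"

definition dres ::
  "('a::comm_ring_1 \<Rightarrow> 'a) \<Rightarrow> (unit, 'a) dpoly \<Rightarrow> (unit, 'a) dpoly \<Rightarrow> 'a" where
  "dres d f1 f2 = det (dres_matrix d f1 f2)"

section \<open>The implicitization setting\<close>

datatype xy = X | Y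

text \<open>The polynomial \<open>w Q(u) - P(u) \<in> F{x,y}{u}\<close> for \<open>w\<close> one of \<open>x\<close>, \<open>y\<close>\<close>

definition implicit_eq ::
  "xy \<Rightarrow> (unit, 'f::field) dpoly \<Rightarrow> (unit, 'f) dpoly \<Rightarrow> (unit, (xy, 'f) dpoly) dpoly" where
  "implicit_eq w P Q =
     dconst (dvar w 0) * Poly_Mapping.map dconst Q - Poly_Mapping.map dconst P"

end

theory Submission
  imports Defs
begin

text \<open>
  Write \<open>x0 = P1(u)/Q1(u)\<close> and \<open>y0 = P2(u)/Q2(u)\<close> for the coordinates of the parametrization,
  \<open>f1 = x Q1(u) - P1(u)\<close> and \<open>f2 = y Q2(u) - P2(u)\<close> for the two linear equations, and \<open>R\<close> for their
  resultant.

  The derivative \<open>x^(m2)\<close> enters the matrix of \<open>R\<close> only through the row of \<open>f1^(m2)\<close>, and this row is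
  \<open>x^(m2)\<close> times the coefficient vector of \<open>Q1\<close> plus terms of lower order in \<open>x\<close>
  (\<open>implicit_row_form\<close>).  So \<open>R = x^(m2) C + B\<close>, where \<open>C\<close> and \<open>B\<close> do not contain \<open>x^(m2)\<close> and \<open>C\<close> is
  the determinant of the matrix in which the row of \<open>f1^(m2)\<close> is replaced by the coefficients of
  \<open>Q1\<close>.  All claims about \<open>x\<close> follow from \<open>C \<noteq> 0\<close> (\<open>det_affine_in_variable\<close>).  Those about \<open>y\<close> follow
  in the same way from the row of \<open>f2^(m1)\<close>.

  That \<open>C \<noteq> 0\<close> can be checked after the specialization \<open>(x, y) = (x0, y0)\<close>.  Each row of the
  specialized matrix is an affine form in \<open>u, u', u'', \<dots>\<close>.  The forms of the \<open>f1^(k)\<close> and \<open>f2^(k)\<close>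
  vanish at the actual \<open>u\<close>, the form \<open>Q1\<close> does not.  In a linear relation between the rows, the row
  of \<open>Q1\<close> therefore has coefficient 0, and the linear parts give a relation
  \<open>\<Sum>k<m2. a k \<partial>^k h1 + \<Sum>k\<le>m1. b k \<partial>^k h2 = 0\<close> between two linear differential operators \<open>h1\<close>, \<open>h2\<close>.
  Their orders are exactly \<open>m1\<close> and \<open>m2\<close> because \<open>x0\<close> and \<open>y0\<close> do not lie in \<open>F\<close>
  (\<open>degree_equation_operator\<close>).

  Properness excludes such a relation.  It says that \<open>u\<close> is a differential rational function of
  \<open>x0\<close> and \<open>y0\<close>.  As \<open>u\<close> is differentially transcendental, this identity can be differentiated with
  respect to \<open>u\<close>; up to factors, \<open>h1\<close> and \<open>h2\<close> are the linearizations of \<open>x0\<close> and \<open>y0\<close>, and the chain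
  rule gives \<open>S h1 + T h2 = 1\<close> for some operators \<open>S\<close>, \<open>T\<close> (\<open>one_in_left_ideal_gen\<close>).  So, with
  coefficients in a differential field \<open>K\<close> containing \<open>u\<close>, the operators \<open>\<partial>^k h1\<close> span \<open>K[\<partial>]\<close> modulo
  \<open>K[\<partial>] h2\<close>.  This quotient has dimension \<open>m2\<close>, whereas a relation as above would make \<open>r\<close> of these
  operators span it for some \<open>r < m2\<close> (\<open>no_relation_of_low_order\<close>).
\<close>

hide_const (open) up_ring.coeff up_ring.monom Module.smult

section \<open>Evaluation of differential polynomials\<close>

lemma single_monom_eq_prod:
  fixes m :: "'v \<Rightarrow>\<^sub>0 nat"
  shows "Poly_Mapping.single m (1 :: 'a::comm_ring_1) =
    (\<Prod>v \<in> Poly_Mapping.keys m. Poly_Mapping.single (Poly_Mapping.single v 1) 1 ^ Poly_Mapping.lookup m v)"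
proof -
  have pow: "Poly_Mapping.single (Poly_Mapping.single v 1) (1::'a) ^ k =
      Poly_Mapping.single (Poly_Mapping.single v k) 1" for k and v :: 'v
    by (induction k) (simp_all add: mult_single flip: single_add)
  have prod: "(\<Prod>v\<in>A. Poly_Mapping.single (h v) (1::'a)) = Poly_Mapping.single (\<Sum>v\<in>A. h v) 1"
    for A and h :: "'v \<Rightarrow> 'v \<Rightarrow>\<^sub>0 nat"
    by (induction A rule: infinite_finite_induct) (simp_all add: mult_single)
  show ?thesis
    by (simp only: pow prod flip: poly_mapping_as_sum)
qed

text \<open>
  Differential polynomials are generated as a ring by the constants and the variables; identities
  between ring homomorphisms or derivations need only be checked on these.
\<close>

lemma dpoly_induct [case_names const var add mult]:
  fixes f :: "('i, 'a::comm_ring_1) dpoly"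
  assumes const: "\<And>c. P (dconst c)" and var: "\<And>i k. P (dvar i k)"
    and add: "\<And>f g. P f \<Longrightarrow> P g \<Longrightarrow> P (f + g)" and mult: "\<And>f g. P f \<Longrightarrow> P g \<Longrightarrow> P (f * g)"
  shows "P f"
proof -
  have "P 1" using const[of 1] by simp
  then have pow: "P (g ^ n)" if "P g" for g :: "('i, 'a) dpoly" and n
    by (induction n) (simp_all add: mult that)
  have prod: "P (\<Prod>v\<in>A. g v)" if "\<And>v. P (g v)" for A :: "('i \<times> nat) set" and g
    by (induction A rule: infinite_finite_induct) (simp_all add: mult that \<open>P 1\<close>)
  have sum: "P (\<Sum>m\<in>A. g m)" if "\<And>m. P (g m)" for A :: "'i dmonom set" and g
    using const[of 0] by (induction A rule: infinite_finite_induct) (simp_all add: add that)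
  have "P (Poly_Mapping.single m c)" for m :: "'i dmonom" and c
  proof -
    have "P (Poly_Mapping.single m 1)"
      using var by (subst single_monom_eq_prod) (auto simp: dvar_def intro!: prod pow)
    from mult[OF const[of c] this] show ?thesis by (simp add: mult_single)
  qed
  then show ?thesis by (subst poly_mapping_as_sum) (rule sum)
qed

definition dpoly_eval ::
  "('a::zero \<Rightarrow> 'b::comm_ring_1) \<Rightarrow> ('i \<Rightarrow> nat \<Rightarrow> 'b) \<Rightarrow> ('i, 'a) dpoly \<Rightarrow> 'b" where
  "dpoly_eval \<sigma> s f = (\<Sum>m \<in> Poly_Mapping.keys f. \<sigma> (Poly_Mapping.lookup f m) *
     (\<Prod>v \<in> Poly_Mapping.keys m. s (fst v) (snd v) ^ Poly_Mapping.lookup m v))"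

context
  fixes \<sigma> :: "'a::comm_ring_1 \<Rightarrow> 'b::comm_ring_1" and s :: "'i \<Rightarrow> nat \<Rightarrow> 'b"
  assumes hom: "comm_ring_hom \<sigma>"
begin

interpretation \<sigma>: comm_ring_hom \<sigma> by (fact hom)

lemma dpoly_eval_superset:
  assumes "finite A" "Poly_Mapping.keys f \<subseteq> A"
  shows "dpoly_eval \<sigma> s f = (\<Sum>m \<in> A. \<sigma> (Poly_Mapping.lookup f m) *
     (\<Prod>v \<in> Poly_Mapping.keys m. s (fst v) (snd v) ^ Poly_Mapping.lookup m v))"
  unfolding dpoly_eval_def
  by (rule sum.mono_neutral_left) (use assms in \<open>auto simp: in_keys_iff\<close>)

lemma dpoly_eval_add: "dpoly_eval \<sigma> s (f + g) = dpoly_eval \<sigma> s f + dpoly_eval \<sigma> s g"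
proof -
  let ?A = "Poly_Mapping.keys f \<union> Poly_Mapping.keys g"
  have "dpoly_eval \<sigma> s h = (\<Sum>m \<in> ?A. \<sigma> (Poly_Mapping.lookup h m) *
     (\<Prod>v \<in> Poly_Mapping.keys m. s (fst v) (snd v) ^ Poly_Mapping.lookup m v))"
    if "Poly_Mapping.keys h \<subseteq> ?A" for h
    using that by (intro dpoly_eval_superset) auto
  then show ?thesis
    using Poly_Mapping.keys_add[of f g]
    by (simp add: lookup_add \<sigma>.hom_add sum.distrib distrib_right)
qed

lemma dpoly_eval_single:
  "dpoly_eval \<sigma> s (Poly_Mapping.single m c) =
     \<sigma> c * (\<Prod>v \<in> Poly_Mapping.keys m. s (fst v) (snd v) ^ Poly_Mapping.lookup m v)"
  by (subst dpoly_eval_superset[where A = "{m}"]) auto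

lemma dpoly_eval_dconst: "dpoly_eval \<sigma> s (dconst c) = \<sigma> c"
  by (simp add: dpoly_eval_single)

lemma dpoly_eval_dvar: "dpoly_eval \<sigma> s (dvar i k) = s i k"
  by (simp add: dvar_def dpoly_eval_single)

lemma dpoly_eval_sum: "dpoly_eval \<sigma> s (\<Sum>x\<in>A. h x) = (\<Sum>x\<in>A. dpoly_eval \<sigma> s (h x))"
  by (induction A rule: infinite_finite_induct)
     (auto simp: dpoly_eval_add, auto simp: dpoly_eval_def)

lemma dpoly_eval_mult: "dpoly_eval \<sigma> s (f * g) = dpoly_eval \<sigma> s f * dpoly_eval \<sigma> s g"
proof -
  let ?p = "\<lambda>m. \<Prod>v \<in> Poly_Mapping.keys m. s (fst v) (snd v) ^ Poly_Mapping.lookup m v"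
  have sup: "?p m = (\<Prod>v \<in> V. s (fst v) (snd v) ^ Poly_Mapping.lookup m v)"
    if "finite V" "Poly_Mapping.keys m \<subseteq> V" for m :: "'i dmonom" and V
    by (rule prod.mono_neutral_left) (use that in \<open>auto simp: in_keys_iff\<close>)
  have p: "?p (m + n) = ?p m * ?p n" for m n :: "'i dmonom"
  proof -
    let ?V = "Poly_Mapping.keys m \<union> Poly_Mapping.keys n"
    have "?p (m + n) = (\<Prod>v \<in> ?V. s (fst v) (snd v) ^ Poly_Mapping.lookup (m + n) v)"
      using Poly_Mapping.keys_add[of m n] by (intro sup) auto
    then show ?thesis
      by (simp add: sup[of ?V m] sup[of ?V n] lookup_add power_add prod.distrib)
  qed
  let ?m = "\<lambda>f m. Poly_Mapping.single m (Poly_Mapping.lookup f m)"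
  let ?F = "Poly_Mapping.keys f" and ?G = "Poly_Mapping.keys g"
  have "f * g = (\<Sum>m\<in>?F. \<Sum>n\<in>?G. ?m f m * ?m g n)"
    by (subst poly_mapping_as_sum[of f], subst poly_mapping_as_sum[of g]) (rule sum_product)
  then have "dpoly_eval \<sigma> s (f * g) =
      (\<Sum>m\<in>?F. \<Sum>n\<in>?G. dpoly_eval \<sigma> s (?m f m) * dpoly_eval \<sigma> s (?m g n))"
    by (simp add: dpoly_eval_sum mult_single dpoly_eval_single p \<sigma>.hom_mult algebra_simps)
  also have "\<dots> = dpoly_eval \<sigma> s f * dpoly_eval \<sigma> s g"
    by (simp add: dpoly_eval_single flip: sum_product) (simp add: dpoly_eval_def)
  finally show ?thesis .
qed

lemma comm_ring_hom_dpoly_eval: "comm_ring_hom (dpoly_eval \<sigma> s)"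
  by unfold_locales
     (simp_all add: dpoly_eval_add dpoly_eval_mult dpoly_eval_dconst flip: single_one,
      simp add: dpoly_eval_def)

end

lemma dpoly_eval_deriv:
  fixes \<sigma> :: "'a::comm_ring_1 \<Rightarrow> 'b::comm_ring_1"
  assumes \<sigma>: "comm_ring_hom \<sigma>" and d: "derivation d" and d': "derivation d'"
    and "\<And>c. \<sigma> (d c) = d' (\<sigma> c)" and "\<And>i k. s i (Suc k) = d' (s i k)"
  shows "dpoly_eval \<sigma> s (dpoly_deriv d f) = d' (dpoly_eval \<sigma> s f)"
proof (induction f rule: dpoly_induct)
  case (add f g)
  then show ?case
    using d' by (simp add: dpoly_deriv_add[OF d] dpoly_eval_add[OF \<sigma>] derivation_def)
next
  case (mult f g)
  have "dpoly_deriv d (f * g) = dpoly_deriv d f * g + f * dpoly_deriv d g"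
    using derivation_dpoly_deriv[OF d, where 'b = 'i] unfolding derivation_def by blast
  then show ?case
    using mult d' by (simp add: dpoly_eval_add[OF \<sigma>] dpoly_eval_mult[OF \<sigma>] derivation_def)
qed (simp_all add: assms dpoly_eval_dconst dpoly_eval_dvar dpoly_deriv_dconst dpoly_deriv_dvar)

lemma deval_eq_dpoly_eval: "deval \<iota> dE u = dpoly_eval \<iota> (\<lambda>_ k. (dE ^^ k) u)"
proof
  fix f
  have "(\<Prod>k | ((), k) \<in> Poly_Mapping.keys m. (dE ^^ k) u ^ Poly_Mapping.lookup m ((), k)) =
    (\<Prod>v \<in> Poly_Mapping.keys m. (dE ^^ snd v) u ^ Poly_Mapping.lookup m v)" for m :: "unit dmonom"
    by (rule prod.reindex_bij_witness[of _ snd "Pair ()"]) auto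
  then show "deval \<iota> dE u f = dpoly_eval \<iota> (\<lambda>_ k. (dE ^^ k) u) f"
    by (simp add: deval_def dpoly_eval_def)
qed

section \<open>Affine parts and orders\<close>

text \<open>
  Counting the monomial \<open>1\<close> as number \<open>0\<close> and the \<open>k\<close>-th derivative as number \<open>Suc k\<close> puts the
  constant terms and the linear coefficients into one coefficient vector.  Its reversal is a row of
  the resultant matrix.
\<close>

fun affine_monom :: "nat \<Rightarrow> unit dmonom" where
  "affine_monom 0 = 0"
| "affine_monom (Suc k) = Poly_Mapping.single ((), k) 1"

definition affine_coeff :: "(unit, 'a::zero) dpoly \<Rightarrow> nat \<Rightarrow> 'a" where
  "affine_coeff f i = Poly_Mapping.lookup f (affine_monom i)"

lemma affine_monom_eq_iff [simp]: "affine_monom i = affine_monom j \<longleftrightarrow> i = j"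
  by (cases i; cases j) (auto simp: poly_mapping_eq_iff fun_eq_iff lookup_single when_def split: if_splits)

lemma affine_monom_shift:
  assumes "Poly_Mapping.lookup m ((), k) \<noteq> 0"
  shows "m - Poly_Mapping.single ((), k) 1 + Poly_Mapping.single ((), Suc k) 1 = affine_monom j \<longleftrightarrow>
    m = affine_monom (Suc k) \<and> j = Suc (Suc k)"
proof
  assume eq: "m - Poly_Mapping.single ((), k) 1 + Poly_Mapping.single ((), Suc k) 1 = affine_monom j"
  then have l: "Poly_Mapping.lookup m ((), l) - (if l = k then 1 else 0) + (if l = Suc k then 1 else 0)
      = Poly_Mapping.lookup (affine_monom j) ((), l)" for l
    by (auto simp: lookup_add lookup_minus lookup_single when_def dest!: arg_cong[of _ _ "\<lambda>p. Poly_Mapping.lookup p ((), l)"])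
  have j: "j = Suc (Suc k)"
    using l[of "Suc k"] by (cases j) (auto simp: lookup_single when_def split: if_splits)
  have "Poly_Mapping.lookup m ((), l) = (if l = k then 1 else 0)" for l
    using l[of l] assms by (auto simp: j lookup_single when_def split: if_splits)
  then show "m = affine_monom (Suc k) \<and> j = Suc (Suc k)"
    by (auto intro!: poly_mapping_eqI simp: j lookup_single when_def)
qed auto

text \<open>
  Differentiation maps a term to terms of the same degree, so the affine part of \<open>f'\<close> depends only
  on the affine part of \<open>f\<close>.  The derivative \<open>u^(k+1)\<close> receives the
  coefficient of \<open>u^(k)\<close>, but \<open>u\<close> itself receives nothing from the constant term.
\<close>

lemma affine_coeff_deriv:
  assumes d: "derivation d"
  shows "affine_coeff (dpoly_deriv d f) j = d (affine_coeff f j) +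
    (case j of Suc (Suc k) \<Rightarrow> affine_coeff f (Suc k) | _ \<Rightarrow> 0)"
proof -
  have monom: "Poly_Mapping.lookup (dterm_deriv d m c) (affine_monom j) =
      d (c when m = affine_monom j) +
      (case j of Suc (Suc k) \<Rightarrow> (c when m = affine_monom (Suc k)) | _ \<Rightarrow> 0)" for m c
  proof -
    have "Poly_Mapping.lookup (\<Sum>(i, k) \<in> Poly_Mapping.keys m.
        Poly_Mapping.single
          (m - Poly_Mapping.single (i, k) 1 + Poly_Mapping.single (i, Suc k) 1)
          (of_nat (Poly_Mapping.lookup m (i, k)) * c)) (affine_monom j) =
       (\<Sum>(i, k) \<in> Poly_Mapping.keys m. c when m = affine_monom (Suc k) \<and> j = Suc (Suc k))"
      unfolding lookup_sum
    proof (intro sum.cong refl, clarify)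
      fix i :: unit and k assume "(i, k) \<in> Poly_Mapping.keys m"
      then have "Poly_Mapping.lookup m ((), k) \<noteq> 0" by (simp add: in_keys_iff)
      from affine_monom_shift[OF this]
      show "Poly_Mapping.lookup (Poly_Mapping.single (m - Poly_Mapping.single (i, k) 1 + Poly_Mapping.single (i, Suc k) 1)
          (of_nat (Poly_Mapping.lookup m (i, k)) * c)) (affine_monom j) =
          (c when m = affine_monom (Suc k) \<and> j = Suc (Suc k))"
        by (auto simp: lookup_single when_def)
    qed
    also have "\<dots> = (case j of Suc (Suc k) \<Rightarrow> (c when m = affine_monom (Suc k)) | _ \<Rightarrow> 0)"
    proof (cases "\<exists>k. m = affine_monom (Suc k) \<and> j = Suc (Suc k)")
      case True then show ?thesis by (auto simp: when_def)
    next
      case False then show ?thesis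
        by (auto simp: when_def split: nat.split intro!: sum.neutral)
    qed
    finally show ?thesis
      by (simp add: dterm_deriv_def lookup_add lookup_single when_def derivation_zero[OF d])
  qed
  have d_sum: "d (\<Sum>x\<in>A. h x) = (\<Sum>x\<in>A. d (h x))" for A :: "unit dmonom set" and h
    using d by (induction A rule: infinite_finite_induct) (auto simp: derivation_zero derivation_def)
  have coeff: "affine_coeff f i = (\<Sum>m\<in>Poly_Mapping.keys f. Poly_Mapping.lookup f m when m = affine_monom i)" for i
    by (simp add: affine_coeff_def when_def in_keys_iff)
  have "affine_coeff (dpoly_deriv d f) j =
      (\<Sum>m\<in>Poly_Mapping.keys f. d (Poly_Mapping.lookup f m when m = affine_monom j) +
         (case j of Suc (Suc k) \<Rightarrow> (Poly_Mapping.lookup f m when m = affine_monom (Suc k)) | _ \<Rightarrow> 0))"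
    by (simp only: dpoly_deriv_def affine_coeff_def lookup_sum monom)
  then show ?thesis
    by (simp add: coeff d_sum sum.distrib del: affine_monom.simps split: nat.split)
qed

lemma keys_total_degree_le_1:
  assumes f: "total_degree f \<le> 1" and m: "m \<in> Poly_Mapping.keys f"
  obtains i where "m = affine_monom i"
proof -
  have "(\<Sum>v \<in> Poly_Mapping.keys m. Poly_Mapping.lookup m v) \<le> total_degree f"
    unfolding total_degree_def using m by (intro Max_ge) auto
  then have sum: "(\<Sum>v \<in> Poly_Mapping.keys m. Poly_Mapping.lookup m v) \<le> 1" using f by simp
  show thesis
  proof (cases "m = 0")
    case True
    then show ?thesis using that[of 0] by simp
  next
    case False
    then have "Poly_Mapping.keys m \<noteq> {}" by simp
    then obtain v where v: "v \<in> Poly_Mapping.keys m" by blast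
    have "(\<Sum>v \<in> Poly_Mapping.keys m. Poly_Mapping.lookup m v) =
      Poly_Mapping.lookup m v + (\<Sum>w \<in> Poly_Mapping.keys m - {v}. Poly_Mapping.lookup m w)"
      using v by (simp add: sum.remove)
    moreover have "Poly_Mapping.lookup m v \<noteq> 0" using v by (simp add: in_keys_iff)
    ultimately have 1: "Poly_Mapping.lookup m v = 1"
      and "(\<Sum>w \<in> Poly_Mapping.keys m - {v}. Poly_Mapping.lookup m w) = 0"
      using sum by linarith+
    then have "\<forall>w \<in> Poly_Mapping.keys m - {v}. Poly_Mapping.lookup m w = 0"
      by (subst (asm) sum_eq_0_iff) auto
    then have "Poly_Mapping.lookup m w = 0" if "w \<noteq> v" for w
      using that by (cases w) (auto simp: in_keys_iff)
    with 1 have "m = Poly_Mapping.single v 1"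
      by (intro poly_mapping_eqI) (auto simp: lookup_single when_def)
    then show ?thesis using that[of "Suc (snd v)"] by (cases v) simp
  qed
qed

lemma affine_expansion:
  fixes f :: "(unit, 'a::comm_ring_1) dpoly"
  assumes f: "total_degree f \<le> 1" and n: "\<And>i. n < i \<Longrightarrow> affine_coeff f i = 0"
  shows "f = dconst (affine_coeff f 0) + (\<Sum>k<n. dconst (affine_coeff f (Suc k)) * dvar () k)"
proof -
  have keys: "Poly_Mapping.keys f \<subseteq> affine_monom ` {..n}"
  proof
    fix m assume m: "m \<in> Poly_Mapping.keys f"
    obtain i where i: "m = affine_monom i" using keys_total_degree_le_1[OF f m] by blast
    with m n[of i] show "m \<in> affine_monom ` {..n}"
      by (force simp: affine_coeff_def in_keys_iff not_le)
  qed
  have "f = (\<Sum>m\<in>affine_monom ` {..n}. Poly_Mapping.single m (Poly_Mapping.lookup f m))"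
    by (subst poly_mapping_as_sum, rule sum.mono_neutral_left) (use keys in \<open>auto simp: in_keys_iff\<close>)
  also have "\<dots> = (\<Sum>i\<le>n. Poly_Mapping.single (affine_monom i) (affine_coeff f i))"
    by (subst sum.reindex) (auto simp: inj_on_def affine_coeff_def)
  also have "\<dots> = dconst (affine_coeff f 0) +
      (\<Sum>k<n. Poly_Mapping.single (affine_monom (Suc k)) (affine_coeff f (Suc k)))"
    by (subst sum.atMost_shift) simp
  finally show ?thesis by (simp add: dvar_def mult_single)
qed

lemma affine_coeff_eventually_0:
  obtains n where "\<And>i. n < i \<Longrightarrow> affine_coeff f i = 0"
proof -
  have "finite (affine_monom -` Poly_Mapping.keys f)"
    by (intro finite_vimageI) (auto simp: inj_on_def)
  then obtain n where "affine_monom -` Poly_Mapping.keys f \<subseteq> {..n}"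
    using finite_nat_iff_bounded_le by blast
  then show thesis by (intro that[of n]) (auto simp: affine_coeff_def in_keys_iff not_le subset_iff)
qed

lemma occurs_iff_affine_coeff:
  assumes "total_degree f \<le> 1"
  shows "occurs () k f \<longleftrightarrow> affine_coeff f (Suc k) \<noteq> 0"
proof
  assume "occurs () k f"
  then obtain m where m: "m \<in> Poly_Mapping.keys f" "Poly_Mapping.lookup m ((), k) \<noteq> 0"
    by (auto simp: occurs_def)
  obtain i where i: "m = affine_monom i" using keys_total_degree_le_1[OF assms m(1)] by blast
  with m(2) have "i = Suc k" by (cases i) (auto simp: lookup_single when_def split: if_splits)
  with m(1) i show "affine_coeff f (Suc k) \<noteq> 0" by (simp add: affine_coeff_def in_keys_iff)
next
  assume "affine_coeff f (Suc k) \<noteq> 0"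
  then show "occurs () k f"
    by (auto simp: affine_coeff_def occurs_def in_keys_iff lookup_single intro!: bexI[of _ "affine_monom (Suc k)"])
qed

lemma dord_eq_Fin_iff: "dord i f = Fin n \<longleftrightarrow> occurs i n f \<and> (\<forall>k. occurs i k f \<longrightarrow> k \<le> n)"
proof -
  have "{k. occurs i k f} = (\<Union>m \<in> Poly_Mapping.keys f. Pair i -` Poly_Mapping.keys m)"
    by (auto simp: occurs_def in_keys_iff)
  then have fin: "finite {k. occurs i k f}"
    by (auto intro!: finite_vimageI simp: inj_on_def)
  show ?thesis
    using Max_in[OF fin] Max_ge[OF fin] by (auto simp: dord_def intro!: Max_eqI fin)
qed

lemma rat_ord_eq_FinD:
  assumes "rat_ord P Q = Fin m"
  shows "occurs () m P \<or> occurs () m Q" "occurs () k P \<or> occurs () k Q \<Longrightarrow> k \<le> m"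
proof -
  have *: "dord () f = -\<infinity> \<or> (\<exists>n. dord () f = Fin n)" for f :: "(unit, 'a) dpoly"
    by (auto simp: dord_def)
  have none: "dord () f = -\<infinity> \<Longrightarrow> \<not> occurs () k f" for k and f :: "(unit, 'a) dpoly"
    by (auto simp: dord_def split: if_splits)
  from *[of P] *[of Q] assms
  have "(occurs () m P \<or> occurs () m Q) \<and> (\<forall>k. occurs () k P \<or> occurs () k Q \<longrightarrow> k \<le> m)"
    unfolding rat_ord_def
    by (elim disjE exE; force simp: dord_eq_Fin_iff max_def split: if_splits dest: none)
  then show "occurs () m P \<or> occurs () m Q" "occurs () k P \<or> occurs () k Q \<Longrightarrow> k \<le> m" by auto
qed

lemma affine_coeff_eq_0_above_order:
  assumes "total_degree P \<le> 1" "total_degree Q \<le> 1" "rat_ord P Q = Fin m" "Suc m < i"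
  shows "affine_coeff P i = 0" "affine_coeff Q i = 0"
proof -
  obtain k where i: "i = Suc k" and "m < k" using assms(4) by (cases i) auto
  then have "\<not> occurs () k P" "\<not> occurs () k Q" using rat_ord_eq_FinD(2)[OF assms(3), of k] by auto
  then show "affine_coeff P i = 0" "affine_coeff Q i = 0"
    by (simp_all only: i occurs_iff_affine_coeff assms(1,2) not_not)
qed

text \<open>
  Substituting a polynomial variable for one derivative and 0 for all others is a ring homomorphism
  to \<open>'a poly\<close>.  If that derivative occurs in \<open>f\<close>, the image of \<open>f\<close> has degree 1 and is not a unit.
\<close>

lemma affine_unit_const:
  fixes f :: "(unit, 'a::field) dpoly"
  assumes f: "total_degree f \<le> 1" and unit: "f dvd 1"
  shows "\<not> occurs () k f"
proof
  assume occ: "occurs () k f"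
  have hom: "comm_ring_hom (\<lambda>c::'a. [:c:])"
    by unfold_locales (simp_all add: one_pCons)
  let ?e = "dpoly_eval (\<lambda>c. [:c:]) (\<lambda>_ j. if j = k then [:0, 1:] else 0 :: 'a poly)"
  interpret e: comm_ring_hom ?e by (rule comm_ring_hom_dpoly_eval[OF hom])
  obtain n where n: "\<And>i. n < i \<Longrightarrow> affine_coeff f i = 0" by (rule affine_coeff_eventually_0[where f = f]) auto
  have "\<not> n < Suc k" using occ n[of "Suc k"] by (auto simp: occurs_iff_affine_coeff[OF f])
  then have "k < n" by simp
  have "?e f = [:affine_coeff f 0:] + (\<Sum>j<n. [:affine_coeff f (Suc j):] * (if j = k then [:0, 1:] else 0))"
    by (subst affine_expansion[OF f n])
       (simp_all only: e.hom_add e.hom_sum e.hom_mult dpoly_eval_dconst[OF hom] dpoly_eval_dvar[OF hom])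
  also have "(\<Sum>j<n. [:affine_coeff f (Suc j):] * (if j = k then [:0, 1:] else 0)) =
      (\<Sum>j<n. if j = k then [:affine_coeff f (Suc k):] * [:0, 1:] else 0)"
    by (intro sum.cong) auto
  also have "\<dots> = [:0, affine_coeff f (Suc k):]" using \<open>k < n\<close> by simp
  finally have "?e f = [:affine_coeff f 0, affine_coeff f (Suc k):]" by simp
  moreover have "?e f dvd 1" using e.hom_dvd[OF unit] by simp
  ultimately show False
    using occ by (auto simp: occurs_iff_affine_coeff[OF f] is_unit_pCons_iff)
qed

section \<open>Linear differential operators\<close>

text \<open>
  A polynomial \<open>\<Sum>k. c k X^k\<close> stands for the linear differential operator \<open>\<Sum>k. c k \<partial>^k\<close>.
  Composition with \<open>\<partial>\<close> on the left follows the rule \<open>\<partial> c = c' + c \<partial>\<close>; it is the only composition that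
  is used, so the commutative multiplication of polynomials does no harm.
\<close>

definition deriv_comp :: "('a::comm_ring_1 \<Rightarrow> 'a) \<Rightarrow> 'a poly \<Rightarrow> 'a poly" where
  "deriv_comp d p = map_poly d p + pCons 0 p"

inductive_set left_ideal_gen :: "('a::comm_ring_1 \<Rightarrow> 'a) \<Rightarrow> 'a poly set \<Rightarrow> 'a poly set"
  for d and H where
  zero: "0 \<in> left_ideal_gen d H"
| gen: "h \<in> H \<Longrightarrow> h \<in> left_ideal_gen d H"
| add: "p \<in> left_ideal_gen d H \<Longrightarrow> q \<in> left_ideal_gen d H \<Longrightarrow> p + q \<in> left_ideal_gen d H"
| smult: "p \<in> left_ideal_gen d H \<Longrightarrow> smult c p \<in> left_ideal_gen d H"
| deriv: "p \<in> left_ideal_gen d H \<Longrightarrow> deriv_comp d p \<in> left_ideal_gen d H"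

lemma derivation_diff: "derivation d \<Longrightarrow> d (a - b) = d a - d b"
  unfolding derivation_def by (metis add_diff_cancel diff_add_cancel)

lemma derivation_divide:
  fixes d :: "'a::field \<Rightarrow> 'a"
  assumes d: "derivation d" and "b \<noteq> 0"
  shows "d (a / b) = (d a * b - a * d b) / (b * b)"
proof -
  have "d a = d (a / b) * b + a / b * d b"
    using d \<open>b \<noteq> 0\<close> unfolding derivation_def by (metis nonzero_eq_divide_eq)
  then show ?thesis using \<open>b \<noteq> 0\<close> by (simp add: field_simps)
qed

lemma coeff_deriv_comp:
  "derivation d \<Longrightarrow>
    coeff (deriv_comp d p) j = d (coeff p j) + (case j of 0 \<Rightarrow> 0 | Suc i \<Rightarrow> coeff p i)"
  by (simp add: deriv_comp_def coeff_map_poly derivation_zero coeff_pCons)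

lemma deriv_comp_0: "deriv_comp d 0 = 0"
  by (simp add: deriv_comp_def)

lemma deriv_comp_add:
  "derivation d \<Longrightarrow> deriv_comp d (p + q) = deriv_comp d p + deriv_comp d q"
  by (rule poly_eqI) (simp add: coeff_deriv_comp derivation_def split: nat.split)

lemma deriv_comp_smult:
  "derivation d \<Longrightarrow> deriv_comp d (smult c p) =
    smult (d c) p + smult c (deriv_comp d p)"
  by (rule poly_eqI) (simp add: coeff_deriv_comp derivation_def algebra_simps split: nat.split)

lemma deriv_comp_diff:
  "derivation d \<Longrightarrow> deriv_comp d (p - q) = deriv_comp d p - deriv_comp d q"
  by (rule poly_eqI) (simp add: coeff_deriv_comp derivation_diff split: nat.split)

lemma left_ideal_gen_diff:
  assumes "p \<in> left_ideal_gen d H" "q \<in> left_ideal_gen d H"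
  shows "p - q \<in> left_ideal_gen d H"
  using left_ideal_gen.add[OF assms(1) left_ideal_gen.smult[OF assms(2), of "-1"]] by simp

lemma degree_deriv_comp:
  assumes d: "derivation d" and "p \<noteq> 0"
  shows "degree (deriv_comp d p) = Suc (degree p)" "deriv_comp d p \<noteq> 0"
proof -
  have top: "coeff (deriv_comp d p) (Suc (degree p)) \<noteq> 0"
    using \<open>p \<noteq> 0\<close> by (simp add: coeff_deriv_comp[OF d] coeff_eq_0 derivation_zero[OF d])
  have "degree (deriv_comp d p) \<le> Suc (degree p)"
    by (rule degree_le) (auto simp: coeff_deriv_comp[OF d] coeff_eq_0 derivation_zero[OF d] split: nat.split)
  then show "degree (deriv_comp d p) = Suc (degree p)"
    using le_degree[OF top] by simp
  show "deriv_comp d p \<noteq> 0" using top by auto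
qed

lemma degree_deriv_comp_funpow:
  assumes "derivation d" "p \<noteq> 0"
  shows "degree ((deriv_comp d ^^ k) p) = degree p + k" "(deriv_comp d ^^ k) p \<noteq> 0"
  by (induction k) (simp_all add: degree_deriv_comp assms)

lemma deriv_comp_funpow_1: "derivation d \<Longrightarrow> (deriv_comp d ^^ k) 1 = monom 1 k"
proof (induction k)
  case (Suc k)
  have "d 1 = 0"
    using Suc.prems unfolding derivation_def by (metis add_cancel_right_right mult_1_left mult_1_right)
  then have "map_poly d (monom 1 k) = 0"
    by (intro poly_eqI) (simp add: coeff_map_poly derivation_zero[OF Suc.prems])
  then show ?case using Suc by (simp add: deriv_comp_def monom_Suc)
qed simp

lemma combination_consecutive_degrees_eq_0:
  fixes p :: "nat \<Rightarrow> 'a::idom poly"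
  assumes "\<And>j. j < n \<Longrightarrow> degree (p j) = m + j \<and> p j \<noteq> 0"
    and "(\<Sum>j<n. smult (c j) (p j)) = 0" "j < n"
  shows "c j = 0"
  using assms
proof (induction n arbitrary: j)
  case (Suc n)
  have "coeff (\<Sum>j<n. smult (c j) (p j)) (m + n) = 0"
    using Suc.prems(1) by (auto simp: coeff_sum coeff_eq_0)
  then have "c n * coeff (p n) (m + n) = 0"
    using arg_cong[OF Suc.prems(2), of "\<lambda>q. coeff q (m + n)"] by simp
  moreover have "coeff (p n) (m + n) \<noteq> 0"
    using Suc.prems(1)[of n] leading_coeff_neq_0[of "p n"] by simp
  ultimately have "c n = 0" by simp
  then show ?case using Suc by (cases "j = n") simp_all
qed simp

text \<open>
  In the left vector space \<open>K[\<partial>] / K[\<partial>] h2\<close> of dimension \<open>degree h2\<close>, the operators \<open>\<partial>^k h1\<close> span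
  everything, because the left ideal generated by \<open>h1\<close> and \<open>h2\<close> contains \<open>1\<close>.  If \<open>a r\<close> is the last nonzero
  coefficient \<open>a k\<close>, then \<open>\<partial>^r h1\<close> is a combination of the lower ones modulo \<open>K[\<partial>] h2\<close>, and by
  differentiation so are all later ones.  Then \<open>r < degree h2\<close> elements would span a space of dimension
  \<open>degree h2\<close>.  Hence all \<open>a k\<close> vanish; the \<open>b k\<close> vanish because the orders of the \<open>\<partial>^k h2\<close> differ.
\<close>

lemma no_relation_of_low_order:
  fixes h1 h2 :: "'a::field poly"
  assumes d: "derivation d" and one: "1 \<in> left_ideal_gen d {h1, h2}" and h2: "h2 \<noteq> 0"
    and rel: "(\<Sum>k<degree h2. smult (a k) ((deriv_comp d ^^ k) h1)) +
      (\<Sum>k<n. smult (b k) ((deriv_comp d ^^ k) h2)) = 0"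
  shows "k < degree h2 \<Longrightarrow> a k = 0" "k < n \<Longrightarrow> b k = 0"
proof -
  interpret V: vector_space "smult :: 'a \<Rightarrow> 'a poly \<Rightarrow> 'a poly"
    by unfold_locales (simp_all add: smult_add_left smult_add_right)
  define D where "D = (\<lambda>k. deriv_comp d ^^ k)"
  have D_Suc: "D (Suc k) p = deriv_comp d (D k p)" for k p by (simp add: D_def)
  have D_0: "D 0 p = p" for p by (simp add: D_def)
  have a: "\<forall>k<degree h2. a k = 0"
  proof (rule ccontr)
    assume "\<not> ?thesis"
    then obtain k0 where "k0 < degree h2 \<and> a k0 \<noteq> 0" by blast
    then obtain r where r: "r < degree h2" "a r \<noteq> 0" and max: "\<And>k. k < degree h2 \<Longrightarrow> r < k \<Longrightarrow> a k = 0"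
      using Nat.ex_has_greatest_nat[of "\<lambda>k. k < degree h2 \<and> a k \<noteq> 0" k0 "degree h2"]
      by (meson less_imp_le not_le)
    define G where "G = (\<lambda>j. D j h1) ` {..<r}"
    define U where "U = V.span (G \<union> range (\<lambda>k. D k h2))"
    define W where "W n = V.span (G \<union> (\<lambda>k. D k h2) ` {..<n})" for n
    have G: "D j h1 \<in> U" if "j < r" for j
      unfolding U_def G_def using that by (intro V.span_base) auto
    have H: "D k h2 \<in> U" for k
      unfolding U_def by (intro V.span_base) auto
    have "(\<Sum>k<degree h2. smult (a k) (D k h1)) =
        (\<Sum>k<Suc r. smult (a k) (D k h1))"
      by (rule sum.mono_neutral_right) (use r max in auto)
    then have "smult (a r) (D r h1) = - (\<Sum>k<r. smult (a k) (D k h1))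
        - (\<Sum>k<n. smult (b k) (D k h2))"
      using rel by (simp add: D_def algebra_simps eq_neg_iff_add_eq_0)
    also have "\<dots> \<in> U"
      using G H unfolding U_def by (intro V.span_diff V.span_neg V.span_sum V.span_scale) auto
    finally have "smult (inverse (a r)) (smult (a r) (D r h1)) \<in> U"
      unfolding U_def by (rule V.span_scale)
    then have top: "D r h1 \<in> U" using r by simp
    have gen: "deriv_comp d x \<in> U" if x: "x \<in> G \<union> range (\<lambda>k. D k h2)" for x
      using x
    proof
      assume "x \<in> G"
      then obtain j where j: "j < r" "x = D j h1" by (auto simp: G_def)
      then have "D (Suc j) h1 \<in> U" using G[of "Suc j"] top by (cases "Suc j = r") auto
      then show ?thesis by (simp add: j D_Suc)
    next
      assume "x \<in> range (\<lambda>k. D k h2)"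
      then obtain k where "x = D k h2" by blast
      then show ?thesis using H[of "Suc k"] by (simp add: D_Suc)
    qed
    have closed: "deriv_comp d x \<in> U" if "x \<in> U" for x
      using that unfolding U_def
    proof (induction rule: V.span_induct_alt)
      case base
      show ?case by (simp add: deriv_comp_0 V.span_zero)
    next
      case (step c x y)
      then show ?case
        using gen[OF step(1)] V.span_base[OF step(1)] unfolding U_def deriv_comp_add[OF d] deriv_comp_smult[OF d]
        by (intro V.span_add V.span_scale)
    qed
    have "x \<in> U" if "x \<in> left_ideal_gen d {h1, h2}" for x
      using that
    proof induction
      case (gen h)
      have "h1 \<in> U" using G[of 0] top by (cases "r = 0") (auto simp: D_0)
      then show ?case using gen H[of 0] by (auto simp: D_0)
    qed (use closed in \<open>auto simp: U_def V.span_zero V.span_add V.span_scale\<close>)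
    with one have "D k 1 \<in> U" for k
      by (induction k) (auto simp: D_0 D_Suc closed)
    then have monom: "monom 1 k \<in> U" for k
      by (simp add: D_def deriv_comp_funpow_1[OF d])
    have W_mono: "W k \<subseteq> W l" if "k \<le> l" for k l
      unfolding W_def using that by (intro V.span_mono) auto
    have U_W: "\<exists>l. x \<in> W l" if "x \<in> U" for x
      using that unfolding U_def
    proof (induction rule: V.span_induct_alt)
      case base
      show ?case by (auto simp: W_def V.span_zero)
    next
      case (step c x y)
      then obtain l where l: "y \<in> W l" by blast
      have "\<exists>l'. x \<in> G \<union> (\<lambda>k. D k h2) ` {..<l'}"
        using step(1) by auto
      then obtain l' where "x \<in> G \<union> (\<lambda>k. D k h2) ` {..<l'}" by blast
      then have "x \<in> W l'" unfolding W_def by (rule V.span_base)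
      then have "x \<in> W (max l l')" "y \<in> W (max l l')"
        using l W_mono[of l "max l l'"] W_mono[of l' "max l l'"] by auto
      then have "smult c x + y \<in> W (max l l')"
        unfolding W_def by (intro V.span_add V.span_scale)
      then show ?case by blast
    qed
    (* Finitely many elements of U already lie in a span with finitely many generators. To compare
       finite dimensions, it is enough to place the powers of X below the degree of h2 into it. *)
    have "\<exists>l. \<forall>k<m. monom 1 k \<in> W l" for m
    proof (induction m)
      case (Suc m)
      then obtain l l' where "\<forall>k<m. monom 1 k \<in> W l" "monom 1 m \<in> W l'" using U_W[OF monom] by blast
      then have "\<forall>k<Suc m. monom 1 k \<in> W (max l l')"
        using W_mono[of l "max l l'"] W_mono[of l' "max l l'"] by (auto simp: less_Suc_eq)
      then show ?case by blast
    qed simp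
    then obtain l where l: "\<And>k. k < degree h2 \<Longrightarrow> monom 1 k \<in> W l" by blast
    (* One operator of each order below degree h2 + l: a linearly independent family in W l, which
       has only r + l generators. *)
    define p where "p j = (if j < degree h2 then monom 1 j else D (j - degree h2) h2)" for j
    let ?N = "degree h2 + l"
    have p: "degree (p j) = 0 + j \<and> p j \<noteq> 0" for j
      using degree_deriv_comp_funpow[OF d h2] by (auto simp: p_def D_def degree_monom_eq)
    have inj: "inj_on p {..<?N}" using p by (metis add_0 inj_onI)
    have "V.independent (p ` {..<?N})"
    proof (subst V.dependent_finite, simp, safe)
      fix c j assume "(\<Sum>v\<in>p ` {..<?N}. smult (c v) v) = 0" "j < ?N" "c (p j) \<noteq> 0"
      then show False
        using combination_consecutive_degrees_eq_0[of ?N p 0 "\<lambda>j. c (p j)" j] p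
        by (simp add: sum.reindex[OF inj])
    qed
    moreover have "p ` {..<?N} \<subseteq> W l"
    proof safe
      fix j assume "j < ?N"
      then have "D (j - degree h2) h2 \<in> W l" if "degree h2 \<le> j"
        unfolding W_def using that by (intro V.span_base) auto
      then show "p j \<in> W l" using l by (auto simp: p_def)
    qed
    ultimately have "card (p ` {..<?N}) \<le> card (G \<union> (\<lambda>k. D k h2) ` {..<l})"
      unfolding W_def by (intro conjunct2[OF V.independent_span_bound]) (auto simp: G_def)
    also have "\<dots> \<le> card G + card ((\<lambda>k. D k h2) ` {..<l})" by (rule card_Un_le)
    also have "\<dots> \<le> r + l"
      unfolding G_def using card_image_le[of "{..<r}" "\<lambda>j. D j h1"] card_image_le[of "{..<l}" "\<lambda>k. D k h2"]
      by simp
    finally show False using r by (simp add: card_image[OF inj])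
  qed
  then show "k < degree h2 \<Longrightarrow> a k = 0" by blast
  have "(\<Sum>k<n. smult (b k) (D k h2)) = 0" using rel a by (simp add: D_def)
  then show "k < n \<Longrightarrow> b k = 0"
    using combination_consecutive_degrees_eq_0[of n "\<lambda>k. D k h2" "degree h2" b k]
      degree_deriv_comp_funpow[OF d h2] by (simp add: D_def)
qed

section \<open>Linearization at a differentially transcendental element\<close>

text \<open>
  The linearization of \<open>f\<close> at \<open>u\<close> is the operator \<open>\<Sum>k. (\<partial>f/\<partial>u^(k))(u) \<partial>^k\<close>.  It is the coefficient of
  \<open>\<epsilon>\<close> in \<open>f(u + \<epsilon> v)\<close>, with \<open>v^(k)\<close> represented by the \<open>k\<close>-th power of the variable.  Evaluating with
  values in \<open>'e poly poly\<close>, where the outer variable is \<open>\<epsilon>\<close>, makes the Leibniz rule a consequence of the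
  product formula for coefficients.
\<close>

definition linearization ::
  "('f::field \<Rightarrow> 'e::field) \<Rightarrow> ('e \<Rightarrow> 'e) \<Rightarrow> 'e \<Rightarrow> (unit, 'f) dpoly \<Rightarrow> 'e poly" where
  "linearization \<iota> dE u f =
     coeff (dpoly_eval (\<lambda>c. [:[:\<iota> c:]:]) (\<lambda>_ k. [:[:(dE ^^ k) u:], monom 1 k:]) f) 1"

text \<open>
  The numerator, in the quotient rule, of the linearization of \<open>f / g\<close>.
\<close>

definition quot_linearization ::
  "('f::field \<Rightarrow> 'e::field) \<Rightarrow> ('e \<Rightarrow> 'e) \<Rightarrow> 'e \<Rightarrow> (unit, 'f) dpoly \<Rightarrow> (unit, 'f) dpoly \<Rightarrow> 'e poly" where
  "quot_linearization \<iota> dE u f g =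
     smult (deval \<iota> dE u g) (linearization \<iota> dE u f) - smult (deval \<iota> dE u f) (linearization \<iota> dE u g)"

context
  fixes \<iota> :: "'f::field \<Rightarrow> 'e::field" and dF :: "'f \<Rightarrow> 'f" and dE :: "'e \<Rightarrow> 'e" and u :: 'e
  assumes ext: "differential_extension \<iota> dF dE"
begin

interpretation \<iota>: field_hom \<iota>
  using ext by (simp add: differential_extension_def)

lemma derivation_dF: "derivation dF" and derivation_dE: "derivation dE"
  and embedding_deriv: "\<iota> (dF a) = dE (\<iota> a)"
  using ext by (auto simp: differential_extension_def)

lemma embedding_hom: "comm_ring_hom \<iota>"
  by unfold_locales

interpretation deval: comm_ring_hom "deval \<iota> dE u"
  unfolding deval_eq_dpoly_eval by (rule comm_ring_hom_dpoly_eval) (rule embedding_hom)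

lemma deval_dconst: "deval \<iota> dE u (dconst c) = \<iota> c"
  and deval_dvar: "deval \<iota> dE u (dvar () k) = (dE ^^ k) u"
  by (simp_all add: deval_eq_dpoly_eval dpoly_eval_dconst dpoly_eval_dvar embedding_hom)

lemma deval_deriv: "deval \<iota> dE u (dpoly_deriv dF f) = dE (deval \<iota> dE u f)"
  unfolding deval_eq_dpoly_eval
  by (intro dpoly_eval_deriv) (simp_all add: embedding_hom derivation_dF derivation_dE embedding_deriv)

lemma linearization_hom: "comm_ring_hom (\<lambda>c. [:[:\<iota> c:]:])"
  by unfold_locales (simp_all add: \<iota>.hom_add \<iota>.hom_mult one_pCons)

lemmas linearization_eval = dpoly_eval_add[OF linearization_hom] dpoly_eval_mult[OF linearization_hom]
  dpoly_eval_dconst[OF linearization_hom] dpoly_eval_dvar[OF linearization_hom]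

lemma linearization_dconst: "linearization \<iota> dE u (dconst c) = 0"
  and linearization_dvar: "linearization \<iota> dE u (dvar () k) = monom 1 k"
  and linearization_add:
    "linearization \<iota> dE u (f + g) = linearization \<iota> dE u f + linearization \<iota> dE u g"
  by (simp_all add: linearization_def linearization_eval)

lemma linearization_mult:
  "linearization \<iota> dE u (f * g) =
     smult (deval \<iota> dE u f) (linearization \<iota> dE u g) + smult (deval \<iota> dE u g) (linearization \<iota> dE u f)"
proof -
  have "coeff (dpoly_eval (\<lambda>c. [:[:\<iota> c:]:]) (\<lambda>_ k. [:[:(dE ^^ k) u:], monom 1 k:]) f) 0 =
      [:deval \<iota> dE u f:]" for f
    by (induction f rule: dpoly_induct)
       (simp_all add: linearization_eval deval_dconst deval_dvar deval.hom_add deval.hom_mult coeff_mult)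
  then show ?thesis
    by (simp add: linearization_def linearization_eval coeff_mult algebra_simps)
qed

lemma linearization_sum: "linearization \<iota> dE u (\<Sum>x\<in>A. h x) = (\<Sum>x\<in>A. linearization \<iota> dE u (h x))"
  using linearization_dconst[of 0]
  by (induction A rule: infinite_finite_induct) (simp_all add: linearization_add)

lemma linearization_diff:
  "linearization \<iota> dE u (f - g) = linearization \<iota> dE u f - linearization \<iota> dE u g"
  using linearization_add[of "f - g" g] by simp

text \<open>
  Varying \<open>u\<close> commutes with differentiating: the variation of \<open>f'\<close> is the derivative of the variation
  of \<open>f\<close>.
\<close>

lemma linearization_deriv:
  "linearization \<iota> dE u (dpoly_deriv dF f) = deriv_comp dE (linearization \<iota> dE u f)"
proof (induction f rule: dpoly_induct)
  case (var i k)
  have "map_poly dE (monom 1 k) = 0"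
    using deriv_comp_funpow_1[OF derivation_dE, of "Suc k"] deriv_comp_funpow_1[OF derivation_dE, of k]
    by (simp add: deriv_comp_def monom_Suc)
  then show ?case
    by (simp add: dpoly_deriv_dvar[OF derivation_dF] linearization_dvar deriv_comp_def monom_Suc)
next
  case (mult f g)
  have "dpoly_deriv dF (f * g) = dpoly_deriv dF f * g + f * dpoly_deriv dF g"
    using derivation_dpoly_deriv[OF derivation_dF, where 'b = unit] unfolding derivation_def by blast
  then show ?case
    using mult
    by (simp add: linearization_add linearization_mult deval_deriv deriv_comp_add[OF derivation_dE]
        deriv_comp_smult[OF derivation_dE] algebra_simps)
qed (simp_all add: linearization_dconst linearization_add dpoly_deriv_dconst[OF derivation_dF]
    dpoly_deriv_add[OF derivation_dF] deriv_comp_add[OF derivation_dE] deriv_comp_0)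

lemma deval_affine:
  assumes "total_degree f \<le> 1" "\<And>i. n < i \<Longrightarrow> affine_coeff f i = 0"
  shows "deval \<iota> dE u f = \<iota> (affine_coeff f 0) + (\<Sum>k<n. \<iota> (affine_coeff f (Suc k)) * (dE ^^ k) u)"
  by (subst affine_expansion[OF assms]) (simp_all add: deval.hom_add deval.hom_sum deval.hom_mult deval_dconst deval_dvar)

lemma coeff_linearization_affine:
  assumes f: "total_degree f \<le> 1"
  shows "coeff (linearization \<iota> dE u f) k = \<iota> (affine_coeff f (Suc k))"
proof -
  obtain n where n: "\<And>i. n < i \<Longrightarrow> affine_coeff f i = 0" by (rule affine_coeff_eventually_0[of f]) auto
  have "linearization \<iota> dE u f = (\<Sum>k<n. smult (\<iota> (affine_coeff f (Suc k))) (monom 1 k))"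
    by (subst affine_expansion[OF f n])
       (simp_all add: linearization_add linearization_dconst linearization_sum linearization_mult
         linearization_dvar deval_dconst)
  then show ?thesis
    using n[of "Suc k"] by (auto simp: coeff_sum if_distrib cong: if_cong)
qed

text \<open>
  If \<open>W\<close> is the numerator belonging to \<open>f / g\<close>, the linearization of \<open>(f / g)'\<close> is \<open>\<partial> (W / g\<^sup>2)\<close>.  With
  the numerator and denominator of the quotient rule for \<open>(f / g)'\<close>, clearing the denominator \<open>g^4\<close> gives
  the following identity.  Its right-hand side lies in every left ideal that contains \<open>W\<close>.
\<close>

lemma quot_linearization_deriv:
  "quot_linearization \<iota> dE u (dpoly_deriv dF f * g - f * dpoly_deriv dF g) (g * g) =
     smult (deval \<iota> dE u g ^ 2) (deriv_comp dE (quot_linearization \<iota> dE u f g)) -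
     smult (2 * deval \<iota> dE u g * dE (deval \<iota> dE u g)) (quot_linearization \<iota> dE u f g)"
proof -
  have coeff_2: "coeff (2 * p) n = 2 * coeff p n" for p :: "'e poly" and n
    by (simp add: numeral_poly)
  show ?thesis
    by (intro poly_eqI)
       (simp add: quot_linearization_def linearization_diff linearization_mult linearization_deriv
         deval_deriv deval.hom_minus deval.hom_mult deriv_comp_diff[OF derivation_dE]
         deriv_comp_smult[OF derivation_dE] coeff_2 algebra_simps power2_eq_square)
qed

lemma quot_linearization_add:
  "quot_linearization \<iota> dE u (f * g' + f' * g) (g * g') =
     smult (deval \<iota> dE u g' ^ 2) (quot_linearization \<iota> dE u f g) +
     smult (deval \<iota> dE u g ^ 2) (quot_linearization \<iota> dE u f' g')"
  by (rule poly_eqI)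
     (simp add: quot_linearization_def linearization_add linearization_mult deval.hom_add deval.hom_mult
      algebra_simps power2_eq_square)

lemma quot_linearization_mult:
  "quot_linearization \<iota> dE u (f * f') (g * g') =
     smult (deval \<iota> dE u (f' * g')) (quot_linearization \<iota> dE u f g) +
     smult (deval \<iota> dE u (f * g)) (quot_linearization \<iota> dE u f' g')"
  by (rule poly_eqI)
     (simp add: quot_linearization_def linearization_mult deval.hom_mult algebra_simps)

text \<open>
  The quotients \<open>f(u)/g(u)\<close> whose linearization lies in a given left ideal form a differential field
  over \<open>F\<close>, by the sum, product and quotient rules and because linearization commutes with
  differentiation.  If the two given quotients lie in this field and generate \<open>u\<close>, it contains \<open>u\<close>, whose
  linearization is the operator \<open>1\<close>.
\<close>

lemma one_in_left_ideal_gen: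
  assumes trans: "diff_transcendental \<iota> dE u"
    and g: "deval \<iota> dE u g1 \<noteq> 0" "deval \<iota> dE u g2 \<noteq> 0"
    and H: "quot_linearization \<iota> dE u f1 g1 \<in> left_ideal_gen dE H"
       "quot_linearization \<iota> dE u f2 g2 \<in> left_ideal_gen dE H"
    and u: "u \<in> diff_field_gen \<iota> dE {rat_val \<iota> dE u f1 g1, rat_val \<iota> dE u f2 g2}"
  shows "1 \<in> left_ideal_gen dE H"
proof -
  let ?J = "left_ideal_gen dE H"
  define K where "K = {deval \<iota> dE u f / deval \<iota> dE u g | f g.
    deval \<iota> dE u g \<noteq> 0 \<and> quot_linearization \<iota> dE u f g \<in> ?J}"
  have KI: "z \<in> K" if "z = deval \<iota> dE u f / deval \<iota> dE u g" "deval \<iota> dE u g \<noteq> 0"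
    "quot_linearization \<iota> dE u f g \<in> ?J" for f g z
    using that unfolding K_def by blast
  have const: "\<iota> c \<in> K" for c
    by (rule KI[of _ "dconst c" "dconst 1"])
       (simp_all add: deval_dconst quot_linearization_def linearization_dconst
         linearization_dconst[of 1, simplified] left_ideal_gen.zero)
  have "differential_subfield dE K"
    unfolding differential_subfield_def
  proof (intro conjI ballI)
    show "0 \<in> K" "1 \<in> K" using const[of 0] const[of 1] by simp_all
    fix z assume "z \<in> K"
    then obtain f g where z: "z = deval \<iota> dE u f / deval \<iota> dE u g"
      and g: "deval \<iota> dE u g \<noteq> 0" and J: "quot_linearization \<iota> dE u f g \<in> ?J"
      unfolding K_def by blast
    show "- z \<in> K"
      using left_ideal_gen.smult[OF J, of "- 1"] linearization_diff[of 0 f] linearization_diff[of 0 0]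
      by (intro KI[of _ "- f" g]) (simp_all add: z g deval.hom_uminus quot_linearization_def)
    show "inverse z \<in> K"
    proof (cases "deval \<iota> dE u f = 0")
      case True
      then show ?thesis using const[of 0] by (simp add: z)
    next
      case False
      then show ?thesis
        using left_ideal_gen.smult[OF J, of "- 1"]
        by (intro KI[of _ g f]) (simp_all add: z quot_linearization_def)
    qed
    show "dE z \<in> K"
      using J g unfolding z
      by (intro KI[of _ "dpoly_deriv dF f * g - f * dpoly_deriv dF g" "g * g"])
         (auto simp: derivation_divide[OF derivation_dE] deval_deriv deval.hom_minus deval.hom_mult
           quot_linearization_deriv intro!: left_ideal_gen_diff left_ideal_gen.smult left_ideal_gen.deriv)
    fix z' assume "z' \<in> K"
    then obtain f' g' where z': "z' = deval \<iota> dE u f' / deval \<iota> dE u g'"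
      and g': "deval \<iota> dE u g' \<noteq> 0" and J': "quot_linearization \<iota> dE u f' g' \<in> ?J"
      unfolding K_def by blast
    show "z + z' \<in> K"
      using J J' g g' unfolding z z'
      by (intro KI[of _ "f * g' + f' * g" "g * g'"])
         (auto simp: deval.hom_add deval.hom_mult add_frac_eq
           quot_linearization_add intro!: left_ideal_gen.add left_ideal_gen.smult)
    show "z * z' \<in> K"
      using J J' g g' unfolding z z'
      by (intro KI[of _ "f * f'" "g * g'"])
         (auto simp: deval.hom_mult
           quot_linearization_mult intro!: left_ideal_gen.add left_ideal_gen.smult)
  qed
  moreover have "range \<iota> \<union> {rat_val \<iota> dE u f1 g1, rat_val \<iota> dE u f2 g2} \<subseteq> K"
    using const g H by (auto simp: rat_val_def intro: KI)
  ultimately have "u \<in> K" using u unfolding diff_field_gen_def by blast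
  then obtain f g where fg: "u = deval \<iota> dE u f / deval \<iota> dE u g" "deval \<iota> dE u g \<noteq> 0"
    "quot_linearization \<iota> dE u f g \<in> ?J"
    unfolding K_def by blast
  (* Membership in K is witnessed by some fraction f/g representing u. Transcendence shows f = U g
     as polynomials in the indeterminate U, which determines the linearization. *)
  have "deval \<iota> dE u (f - dvar () 0 * g) = 0"
    using fg(1,2) by (simp add: deval.hom_minus deval.hom_mult deval_dvar nonzero_eq_divide_eq)
  then have "f = dvar () 0 * g" using trans unfolding diff_transcendental_def by auto
  then have "quot_linearization \<iota> dE u f g = smult (deval \<iota> dE u g ^ 2) 1"
    by (intro poly_eqI) (simp add: quot_linearization_def linearization_mult linearization_dvar deval_dvar
      deval.hom_mult algebra_simps power2_eq_square coeff_pCons split: nat.split)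
  then show ?thesis
    using left_ideal_gen.smult[OF fg(3), of "inverse (deval \<iota> dE u g ^ 2)"] fg(2) by (simp add: one_pCons)
qed

end

section \<open>Variables of differential polynomials\<close>

definition dpoly_over :: "('i \<times> nat) set \<Rightarrow> ('i, 'a::zero) dpoly set" where
  "dpoly_over V = {f. \<forall>m \<in> Poly_Mapping.keys f. Poly_Mapping.keys m \<subseteq> V}"

lemma not_occurs_iff: "\<not> occurs i k f \<longleftrightarrow> f \<in> dpoly_over (- {(i, k)})"
proof -
  have "Poly_Mapping.lookup m (i, k) = 0 \<longleftrightarrow> Poly_Mapping.keys m \<subseteq> - {(i, k)}" for m :: "'a dmonom"
    by (subst in_keys_iff[symmetric, THEN arg_cong[of _ _ Not], simplified]) blast
  then show ?thesis by (simp add: occurs_def dpoly_over_def)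
qed

lemma dpoly_over_mono: "V \<subseteq> W \<Longrightarrow> dpoly_over V \<subseteq> dpoly_over W"
  by (auto simp: dpoly_over_def)

lemma dpoly_over_zero: "0 \<in> dpoly_over V"
  and dpoly_over_dconst: "dconst c \<in> dpoly_over V"
  and dpoly_over_dvar: "(i, k) \<in> V \<Longrightarrow> dvar i k \<in> dpoly_over V"
  by (auto simp: dpoly_over_def dvar_def)

lemma dpoly_over_single: "Poly_Mapping.keys m \<subseteq> V \<Longrightarrow> Poly_Mapping.single m c \<in> dpoly_over V"
  by (simp add: dpoly_over_def)

lemma dpoly_over_one: "(1 :: ('i, 'a::zero_neq_one) dpoly) \<in> dpoly_over V"
  using dpoly_over_dconst[of "1 :: 'a"] by simp

lemma dpoly_over_add: "f \<in> dpoly_over V \<Longrightarrow> g \<in> dpoly_over V \<Longrightarrow> f + g \<in> dpoly_over V"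
  using Poly_Mapping.keys_add[of f g] unfolding dpoly_over_def by blast

lemma dpoly_over_uminus: "f \<in> dpoly_over V \<Longrightarrow> - f \<in> dpoly_over V"
  for f :: "('i, 'a::ab_group_add) dpoly"
  by (simp add: dpoly_over_def)

lemma dpoly_over_mult: "f \<in> dpoly_over V \<Longrightarrow> g \<in> dpoly_over V \<Longrightarrow> f * g \<in> dpoly_over V"
  unfolding dpoly_over_def
proof clarify
  fix m v
  assume f: "\<forall>m\<in>Poly_Mapping.keys f. Poly_Mapping.keys m \<subseteq> V"
    and g: "\<forall>m\<in>Poly_Mapping.keys g. Poly_Mapping.keys m \<subseteq> V"
    and m: "m \<in> Poly_Mapping.keys (f * g)" and v: "v \<in> Poly_Mapping.keys m"
  obtain a b where "m = a + b" "a \<in> Poly_Mapping.keys f" "b \<in> Poly_Mapping.keys g"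
    using m Poly_Mapping.keys_mult[of f g] by blast
  then show "v \<in> V" using f g v Poly_Mapping.keys_add[of a b] by blast
qed

lemma dpoly_over_sum: "(\<And>x. x \<in> A \<Longrightarrow> h x \<in> dpoly_over V) \<Longrightarrow> (\<Sum>x\<in>A. h x) \<in> dpoly_over V"
  by (induction A rule: infinite_finite_induct) (auto intro: dpoly_over_zero dpoly_over_add)

lemma dpoly_over_prod: "(\<And>x. x \<in> A \<Longrightarrow> h x \<in> dpoly_over V) \<Longrightarrow> (\<Prod>x\<in>A. h x) \<in> dpoly_over V"
  for h :: "'b \<Rightarrow> ('i, 'a::comm_ring_1) dpoly"
  by (induction A rule: infinite_finite_induct) (auto intro: dpoly_over_one dpoly_over_mult)

lemma dpoly_over_deriv:
  assumes d: "derivation d" and f: "f \<in> dpoly_over V"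
    and V: "V \<subseteq> W" "\<And>i k. (i, k) \<in> V \<Longrightarrow> (i, Suc k) \<in> W"
  shows "dpoly_deriv d f \<in> dpoly_over W"
  unfolding dpoly_deriv_def
proof (rule dpoly_over_sum)
  fix m assume "m \<in> Poly_Mapping.keys f"
  then have m: "Poly_Mapping.keys m \<subseteq> V" using f by (auto simp: dpoly_over_def)
  have "Poly_Mapping.keys (m - Poly_Mapping.single (i, k) 1 + Poly_Mapping.single (i, Suc k) 1) \<subseteq> W"
    if "(i, k) \<in> Poly_Mapping.keys m" for i k
    using m V that by (auto simp: in_keys_iff lookup_add lookup_minus lookup_single when_def subset_iff split: if_splits)
  then show "dterm_deriv d m (Poly_Mapping.lookup f m) \<in> dpoly_over W"
    unfolding dterm_deriv_def
    using m V(1) by (intro dpoly_over_add dpoly_over_sum) (auto intro!: dpoly_over_single)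
qed

text \<open>
  The monomials of \<open>dvar i k * C\<close> contain \<open>dvar i k\<close> exactly once and cannot cancel against \<open>B\<close>.
\<close>

lemma affine_in_variable:
  fixes C B :: "('i, 'a::comm_ring_1) dpoly"
  assumes C: "C \<in> dpoly_over (- {(i, k)})" "C \<noteq> 0" and B: "B \<in> dpoly_over (- {(i, k)})"
  shows "occurs i k (dvar i k * C + B)" "degree_in i k (dvar i k * C + B) = 1"
proof -
  let ?R = "dvar i k * C + B"
  define s :: "'i dmonom" where "s = Poly_Mapping.single (i, k) 1"
  have s: "Poly_Mapping.lookup s (i, k) = 1" by (simp add: s_def)
  have free: "Poly_Mapping.lookup m (i, k) = 0"
    if "f \<in> dpoly_over (- {(i, k)})" "m \<in> Poly_Mapping.keys f" for f :: "('i, 'a) dpoly" and m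
    using that by (force simp: dpoly_over_def in_keys_iff subset_iff)
  have "dvar i k * C = (\<Sum>m\<in>Poly_Mapping.keys C. Poly_Mapping.single (s + m) (Poly_Mapping.lookup C m))"
    by (subst poly_mapping_as_sum[of C]) (simp add: dvar_def s_def sum_distrib_left mult_single)
  then have lookup: "Poly_Mapping.lookup (dvar i k * C) (s + m) = Poly_Mapping.lookup C m" for m
    by (simp add: lookup_sum lookup_single when_def in_keys_iff)
  obtain m where m: "m \<in> Poly_Mapping.keys C" using \<open>C \<noteq> 0\<close> by (metis all_not_in_conv keys_eq_empty)
  have "s + m \<notin> Poly_Mapping.keys B" using free[OF B, of "s + m"] s by (auto simp: lookup_add)
  then have sm: "s + m \<in> Poly_Mapping.keys ?R" using m lookup[of m] by (simp add: in_keys_iff lookup_add)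
  have sm1: "Poly_Mapping.lookup (s + m) (i, k) = 1" using s free[OF C(1) m] by (simp add: lookup_add)
  show "occurs i k ?R" unfolding occurs_def using sm sm1 by force
  have "Poly_Mapping.lookup n (i, k) \<le> 1" if "n \<in> Poly_Mapping.keys ?R" for n
  proof -
    have "n \<in> Poly_Mapping.keys (dvar i k * C) \<or> n \<in> Poly_Mapping.keys B"
      using that Poly_Mapping.keys_add[of "dvar i k * C" B] by blast
    then show ?thesis
    proof
      assume "n \<in> Poly_Mapping.keys (dvar i k * C)"
      then obtain a m' where "a \<in> Poly_Mapping.keys (dvar i k :: ('i, 'a) dpoly)"
        and m': "m' \<in> Poly_Mapping.keys C" "n = a + m'"
        using Poly_Mapping.keys_mult[of "dvar i k" C] by blast
      then have "a = s" by (simp add: dvar_def s_def)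
      with m' show ?thesis using s free[OF C(1)] by (simp add: lookup_add)
    qed (simp add: free[OF B])
  qed
  then show "degree_in i k ?R = 1"
    unfolding degree_in_def using sm sm1
    by (intro Max_eqI) (auto intro: image_eqI[of _ _ "s + m"])
qed

section \<open>Determinants\<close>

lemma det_in_dpoly_over:
  fixes A :: "('i, 'a::comm_ring_1) dpoly mat"
  assumes "A \<in> carrier_mat n n" "\<And>r c. r < n \<Longrightarrow> c < n \<Longrightarrow> A $$ (r, c) \<in> dpoly_over V"
  shows "det A \<in> dpoly_over V"
  unfolding det_def'[OF assms(1)]
proof (intro dpoly_over_sum dpoly_over_mult dpoly_over_prod)
  fix p i assume p: "p \<in> {p. p permutes {0..<n}}" "i \<in> {0..<n}"
  then have "p i < n" using permutes_in_image[of p "{0..<n}" i] by auto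
  with p show "A $$ (i, p i) \<in> dpoly_over V" using assms(2) by auto
next
  fix p :: "nat \<Rightarrow> nat"
  show "signof p \<in> dpoly_over V"
    by (cases "sign p = 1") (auto simp: sign_def intro: dpoly_over_one dpoly_over_uminus)
qed

definition replace_row :: "nat \<Rightarrow> (nat \<Rightarrow> 'a) \<Rightarrow> 'a mat \<Rightarrow> 'a mat" where
  "replace_row r q A = mat (dim_row A) (dim_col A) (\<lambda>(i, j). if i = r then q j else A $$ (i, j))"

text \<open>
  Expand along row \<open>r\<close>: its cofactors do not depend on the row itself.
\<close>

lemma det_affine_row:
  fixes A :: "'a::comm_ring_1 mat"
  assumes A: "A \<in> carrier_mat n n" and r: "r < n" and row: "\<And>c. c < n \<Longrightarrow> A $$ (r, c) = z * q c + b c"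
  shows "det A = z * det (replace_row r q A) + det (replace_row r b A)"
proof -
  have "mat_delete (replace_row r q A) r c = mat_delete A r c" for q c
    using A r by (intro eq_matI) (auto simp: replace_row_def mat_delete_def)
  then have "det (replace_row r q A) = (\<Sum>c<n. q c * cofactor A r c)" for q
    using A r by (subst laplace_expansion_row[of _ n r])
      (auto simp: replace_row_def cofactor_def intro!: sum.cong)
  then show ?thesis
    using laplace_expansion_row[OF A r] row
    by (simp add: sum_distrib_left distrib_right sum.distrib mult.assoc)
qed

text \<open>
  The \<open>k\<close>-th derivative of \<open>i\<close> appears only in row \<open>r\<close>, and there only linearly.  Hence it appears linearly
  in the determinant, with a coefficient that is the determinant after replacing row \<open>r\<close> by the
  coefficients \<open>q\<close>.  As the entries contain no higher derivative of \<open>i\<close>, this coefficient decides the order.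
\<close>

lemma det_affine_in_variable:
  fixes A :: "('i, 'a::comm_ring_1) dpoly mat" and i :: 'i and k :: nat
  defines "V \<equiv> {(i', j). i' = i \<longrightarrow> j < k}"
  assumes A: "A \<in> carrier_mat n n" and r: "r < n"
    and row: "\<And>c. c < n \<Longrightarrow> A $$ (r, c) - dvar i k * q c \<in> dpoly_over V"
    and q: "\<And>c. c < n \<Longrightarrow> q c \<in> dpoly_over V"
    and others: "\<And>r' c. r' < n \<Longrightarrow> c < n \<Longrightarrow> r' \<noteq> r \<Longrightarrow> A $$ (r', c) \<in> dpoly_over V"
    and nz: "det (replace_row r q A) \<noteq> 0"
  shows "det A \<noteq> 0" "dord i (det A) = Fin k" "degree_in i k (det A) = 1"
proof -
  define b where "b c = A $$ (r, c) - dvar i k * q c" for c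
  have over: "det (replace_row r p A) \<in> dpoly_over V" if "\<And>c. c < n \<Longrightarrow> p c \<in> dpoly_over V" for p
    using A that others by (intro det_in_dpoly_over[of _ n]) (auto simp: replace_row_def)
  have V: "dpoly_over V \<subseteq> (dpoly_over (- {(i, k)}) :: ('i, 'a) dpoly set)"
    by (rule dpoly_over_mono) (auto simp: V_def)
  have det: "det A = dvar i k * det (replace_row r q A) + det (replace_row r b A)"
    by (rule det_affine_row[OF A r]) (simp add: b_def)
  have "det (replace_row r q A) \<in> dpoly_over (- {(i, k)})" "det (replace_row r b A) \<in> dpoly_over (- {(i, k)})"
    using V over[of q] over[of b] q row by (auto simp: b_def)
  from affine_in_variable[OF this(1) nz this(2)]
  have occ: "occurs i k (det A)" and deg: "degree_in i k (det A) = 1"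
    unfolding det by blast+
  show "degree_in i k (det A) = 1" by (fact deg)
  show "det A \<noteq> 0" using occ by (auto simp: occurs_def)
  have "j \<le> k" if "occurs i j (det A)" for j
  proof (rule ccontr)
    assume "\<not> j \<le> k"
    then have "V \<subseteq> - {(i, j)}" and "(i, k) \<in> - {(i, j)}" by (auto simp: V_def)
    then have V': "dpoly_over V \<subseteq> (dpoly_over (- {(i, j)}) :: ('i, 'a) dpoly set)"
      and var: "dvar i k \<in> (dpoly_over (- {(i, j)}) :: ('i, 'a) dpoly set)"
      by (simp_all add: dpoly_over_mono dpoly_over_dvar)
    have "det (replace_row r q A) \<in> dpoly_over (- {(i, j)})"
      and "det (replace_row r b A) \<in> dpoly_over (- {(i, j)})"
      using V' over[of q] over[of b] q row by (auto simp: b_def)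
    then have "det A \<in> dpoly_over (- {(i, j)})"
      unfolding det by (intro dpoly_over_add dpoly_over_mult var)
    with that not_occurs_iff[of i j "det A"] show False by simp
  qed
  with occ show "dord i (det A) = Fin k" by (simp add: dord_eq_Fin_iff)
qed

section \<open>The rows of the resultant matrix\<close>

lemma lookup_dconst_mult: "Poly_Mapping.lookup (dconst c * f) m = c * Poly_Mapping.lookup f m"
proof -
  have "dconst c * f = (\<Sum>n\<in>Poly_Mapping.keys f. Poly_Mapping.single n (c * Poly_Mapping.lookup f n))"
    by (subst poly_mapping_as_sum[of f]) (simp add: sum_distrib_left mult_single)
  then show ?thesis by (auto simp: lookup_sum lookup_single when_def in_keys_iff)
qed

lemma lookup_implicit_eq:
  "Poly_Mapping.lookup (implicit_eq w P Q) m =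
     dvar w 0 * dconst (Poly_Mapping.lookup Q m) - dconst (Poly_Mapping.lookup P m)"
  by (simp add: implicit_eq_def lookup_minus lookup_dconst_mult Poly_Mapping.map.rep_eq when_def)

lemma dvar_mult_dconst_eq_dconst_iff:
  "dvar w k * dconst a = dconst b \<longleftrightarrow> a = 0 \<and> b = (0 :: 'a::comm_ring_1)"
proof -
  have "Poly_Mapping.lookup (dvar w k * dconst a - dconst b) 0 = - b"
    and "Poly_Mapping.lookup (dvar w k * dconst a - dconst b) (Poly_Mapping.single (w, k) 1) = a"
    by (simp_all add: dvar_def mult_single lookup_minus lookup_single when_def poly_mapping_eq_iff fun_eq_iff)
  then show ?thesis by (metis diff_self lookup_zero mult_zero_right neg_equal_0_iff_equal single_zero)
qed

lemma occurs_implicit_eq: "occurs () k (implicit_eq w P Q) \<longleftrightarrow> occurs () k P \<or> occurs () k Q"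
proof -
  have "Poly_Mapping.keys (implicit_eq w P Q) = Poly_Mapping.keys P \<union> Poly_Mapping.keys Q"
    by (auto simp: in_keys_iff lookup_implicit_eq dvar_mult_dconst_eq_dconst_iff)
  then show ?thesis by (auto simp: occurs_def)
qed

lemma nat_ord_implicit_eq:
  assumes "rat_ord P Q = Fin m"
  shows "nat_ord (implicit_eq w P Q) = m"
proof -
  have "dord () (implicit_eq w P Q) = Fin m"
    using rat_ord_eq_FinD[OF assms] by (auto simp: dord_eq_Fin_iff occurs_implicit_eq)
  then show ?thesis by (simp add: nat_ord_def)
qed

text \<open>
  By the Leibniz rule, \<open>(w Q - P)^(k)\<close> is \<open>w^(k) Q\<close> plus terms with lower derivatives of \<open>w\<close>.
\<close>

lemma implicit_row_form:
  assumes d: "derivation dF"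
  shows "affine_coeff ((dpoly_deriv (dpoly_deriv dF) ^^ k) (implicit_eq w P Q)) i
    - dvar w k * dconst (affine_coeff Q i) \<in> dpoly_over ({w} \<times> {..<k})"
proof (induction k arbitrary: i)
  case 0
  show ?case
    by (simp add: affine_coeff_def lookup_implicit_eq dpoly_over_uminus dpoly_over_dconst)
next
  case (Suc k)
  let ?D = "dpoly_deriv dF :: (xy, 'a) dpoly \<Rightarrow> (xy, 'a) dpoly"
  let ?e = "\<lambda>i. affine_coeff ((dpoly_deriv ?D ^^ k) (implicit_eq w P Q)) i"
  let ?V = "{w} \<times> {..<Suc k}"
  have D: "derivation ?D" by (rule derivation_dpoly_deriv[OF d])
  define g where "g i = ?e i - dvar w k * dconst (affine_coeff Q i)" for i
  have g: "g i \<in> dpoly_over ({w} \<times> {..<k})" for i using Suc.IH by (simp add: g_def)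
  have e: "?e i = dvar w k * dconst (affine_coeff Q i) + g i" for i by (simp add: g_def)
  have De: "?D (?e i) = dvar w (Suc k) * dconst (affine_coeff Q i) +
      dvar w k * dconst (dF (affine_coeff Q i)) + ?D (g i)" for i
  proof -
    have "?D (a * b + c) = ?D a * b + a * ?D b + ?D c" for a b c
      using D unfolding derivation_def by metis
    then show ?thesis unfolding e by (simp add: dpoly_deriv_dvar[OF d] dpoly_deriv_dconst[OF d])
  qed
  have w: "dvar w k * dconst c \<in> dpoly_over ?V" for c
    by (intro dpoly_over_mult dpoly_over_dvar dpoly_over_dconst) simp
  have "dpoly_over ({w} \<times> {..<k}) \<subseteq> dpoly_over ?V" by (rule dpoly_over_mono) auto
  then have "?e i \<in> dpoly_over ?V" for i
    using g[of i] unfolding e by (intro dpoly_over_add w) auto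
  moreover have "?D (g i) \<in> dpoly_over ?V" for i
    by (rule dpoly_over_deriv[OF d g]) auto
  ultimately have "(dvar w k * dconst (dF (affine_coeff Q i)) + ?D (g i)) +
      (case i of Suc (Suc j) \<Rightarrow> ?e (Suc j) | _ \<Rightarrow> 0) \<in> dpoly_over ?V"
    by (intro dpoly_over_add w) (auto split: nat.split intro: dpoly_over_zero)
  then show ?case
    by (simp only: funpow.simps comp_def affine_coeff_deriv[OF D] De) (simp add: algebra_simps)
qed

lemma implicit_row_over:
  assumes d: "derivation dF"
  shows "affine_coeff ((dpoly_deriv (dpoly_deriv dF) ^^ k) (implicit_eq w P Q)) i \<in> dpoly_over ({w} \<times> {..k})"
proof -
  have "dvar w k * dconst (affine_coeff Q i) \<in> dpoly_over ({w} \<times> {..k})"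
    by (intro dpoly_over_mult dpoly_over_dvar dpoly_over_dconst) simp
  moreover have "dpoly_over ({w} \<times> {..<k}) \<subseteq> dpoly_over ({w} \<times> {..k})"
    by (rule dpoly_over_mono) auto
  ultimately show ?thesis
    using dpoly_over_add[OF subsetD[OF _ implicit_row_form[OF d, of k w P Q i]],
      of "{w} \<times> {..k}" "dvar w k * dconst (affine_coeff Q i)"] by simp
qed

lemma dres_matrix_altdef:
  assumes m: "nat_ord f1 = m1" "nat_ord f2 = m2"
  shows "dres_matrix d f1 f2 = mat (m1 + m2 + 2) (m1 + m2 + 2) (\<lambda>(r, c).
     affine_coeff (if r \<le> m2 then (dpoly_deriv d ^^ (m2 - r)) f1
       else (dpoly_deriv d ^^ (m1 + m2 + 1 - r)) f2) (m1 + m2 + 1 - c))"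
proof -
  let ?rows = "map (\<lambda>k. (dpoly_deriv d ^^ k) f1) (rev [0..<Suc m2]) @
                 map (\<lambda>k. (dpoly_deriv d ^^ k) f2) (rev [0..<Suc m1])"
  let ?monoms = "map (\<lambda>k. Poly_Mapping.single ((), k) 1) (rev [0..<Suc (m1 + m2)]) @ [0] :: unit dmonom list"
  have rows: "?rows ! r = (if r \<le> m2 then (dpoly_deriv d ^^ (m2 - r)) f1
       else (dpoly_deriv d ^^ (m1 + m2 + 1 - r)) f2)" if "r < m1 + m2 + 2" for r
    using that by (auto simp: nth_append rev_nth simp del: upt_Suc)
  have monoms: "?monoms ! c = affine_monom (m1 + m2 + 1 - c)" if "c < m1 + m2 + 2" for c
  proof (cases "c \<le> m1 + m2")
    case True
    then have "m1 + m2 + 1 - c = Suc (m1 + m2 - c)" by simp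
    then show ?thesis using True by (simp add: nth_append rev_nth del: upt_Suc)
  next
    case False
    then have "c = m1 + m2 + 1" using that by simp
    then show ?thesis by (simp add: nth_append del: upt_Suc)
  qed
  show ?thesis
    unfolding dres_matrix_def Let_def m
    by (intro cong_mat refl) (simp only: prod.case rows monoms affine_coeff_def)
qed

section \<open>Nonvanishing of the minors\<close>

lemma sum_lessThan_add_split: "(\<Sum>r<a + b. f r) = (\<Sum>r<a. f r) + (\<Sum>r<b. f (a + r))"
  for f :: "nat \<Rightarrow> 'a::comm_monoid_add"
  by (induction b) (simp_all add: add.assoc)

lemma sum_two_blocks:
  fixes f :: "nat \<Rightarrow> 'a::comm_monoid_add"
  shows "(\<Sum>r<m1 + m2 + 2. f r) = (\<Sum>k<Suc m2. f (m2 - k)) + (\<Sum>k<Suc m1. f (m1 + m2 + 1 - k))"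
proof -
  have "(\<Sum>r<m1 + m2 + 2. f r) = (\<Sum>r<Suc m2. f r) + (\<Sum>r<Suc m1. f (Suc m2 + r))"
    using sum_lessThan_add_split[of f "Suc m2" "Suc m1"] by (simp add: add.commute add.left_commute)
  also have "(\<Sum>r<Suc m2. f r) = (\<Sum>k<Suc m2. f (m2 - k))"
    using sum.nat_diff_reindex[of f "Suc m2"] by simp
  also have "(\<Sum>r<Suc m1. f (Suc m2 + r)) = (\<Sum>k<Suc m1. f (Suc m2 + (m1 - k)))"
    using sum.nat_diff_reindex[of "\<lambda>r. f (Suc m2 + r)" "Suc m1"] by simp
  also have "\<dots> = (\<Sum>k<Suc m1. f (m1 + m2 + 1 - k))"
    by (intro sum.cong refl arg_cong[of _ _ f]) auto
  finally show ?thesis .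
qed

text \<open>
  The matrix is the resultant matrix after specialization, with the row \<open>\<rho>\<close> of the highest derivative
  of \<open>f1\<close> (\<open>\<rho> = 0\<close>) or of \<open>f2\<close> (\<open>\<rho> = Suc m2\<close>) replaced by a form that does not vanish at \<open>U\<close>, while all
  other rows vanish there.  Applying a relation between the rows to \<open>U\<close> removes the special row.  The
  coefficients other than the constant ones then give a relation between the operators \<open>\<partial>^k h1\<close> and
  \<open>\<partial>^k h2\<close> in which one of the highest derivatives is missing.
\<close>

lemma det_augmented_nonzero:
  fixes h1 h2 :: "'e::field poly" and row :: "nat \<Rightarrow> nat \<Rightarrow> 'e" and U :: "nat \<Rightarrow> 'e"
  assumes m1_def: "m1 = degree h1" and m2_def: "m2 = degree h2"
    and d: "derivation d" and one: "1 \<in> left_ideal_gen d {h1, h2}" and h: "h1 \<noteq> 0" "h2 \<noteq> 0"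
    and \<rho>: "\<rho> = 0 \<or> \<rho> = Suc m2"
    and row1: "\<And>k j. k \<le> m2 \<Longrightarrow> m2 - k \<noteq> \<rho> \<Longrightarrow> row (m2 - k) (Suc j) = coeff ((deriv_comp d ^^ k) h1) j"
    and row2: "\<And>k j. k \<le> m1 \<Longrightarrow> m1 + m2 + 1 - k \<noteq> \<rho> \<Longrightarrow>
      row (m1 + m2 + 1 - k) (Suc j) = coeff ((deriv_comp d ^^ k) h2) j"
    and vanish: "\<And>r. r < m1 + m2 + 2 \<Longrightarrow> r \<noteq> \<rho> \<Longrightarrow> (\<Sum>i<m1 + m2 + 2. row r i * U i) = 0"
    and special: "(\<Sum>i<m1 + m2 + 2. row \<rho> i * U i) \<noteq> 0"
  shows "det (mat (m1 + m2 + 2) (m1 + m2 + 2) (\<lambda>(r, c). row r (m1 + m2 + 1 - c))) \<noteq> 0"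
proof
  let ?n = "m1 + m2 + 2"
  let ?A = "mat ?n ?n (\<lambda>(r, c). row r (m1 + m2 + 1 - c))"
  assume "det ?A = 0"
  then have "det (transpose_mat ?A) = 0" by (subst det_transpose[of _ ?n]) auto
  then obtain v where v: "v \<in> carrier_vec ?n" "v \<noteq> 0\<^sub>v ?n" "transpose_mat ?A *\<^sub>v v = 0\<^sub>v ?n"
    using det_0_iff_vec_prod_zero_field[of "transpose_mat ?A" ?n] by auto
  have rel: "(\<Sum>r<?n. v $ r * row r i) = 0" if "i < ?n" for i
  proof -
    have "(transpose_mat ?A *\<^sub>v v) $ (m1 + m2 + 1 - i) = 0" using v(3) that by simp
    then show ?thesis
      using that v(1) by (simp add: mult_mat_vec_def scalar_prod_def atLeast0LessThan mult.commute)
  qed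
  have \<rho>_less: "\<rho> < ?n" using \<rho> by auto
  have "(\<Sum>i<?n. (\<Sum>r<?n. v $ r * row r i) * U i) = 0" using rel by simp
  also have "(\<Sum>i<?n. (\<Sum>r<?n. v $ r * row r i) * U i) = (\<Sum>r<?n. v $ r * (\<Sum>i<?n. row r i * U i))"
    by (simp only: sum_distrib_right sum_distrib_left mult.assoc) (rule sum.swap)
  also have "\<dots> = (\<Sum>r<?n. if r = \<rho> then v $ \<rho> * (\<Sum>i<?n. row \<rho> i * U i) else 0)"
    using vanish by (intro sum.cong) auto
  also have "\<dots> = v $ \<rho> * (\<Sum>i<?n. row \<rho> i * U i)"
    using \<rho>_less by (simp only: sum.delta finite_lessThan lessThan_iff if_True)
  finally have v\<rho>: "v $ \<rho> = 0" using special by simp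
  define a where "a k = v $ (m2 - k)" for k
  define b where "b k = v $ (m1 + m2 + 1 - k)" for k
  let ?D = "\<lambda>k. deriv_comp d ^^ k"
  have row1': "a k * row (m2 - k) (Suc j) = a k * coeff (?D k h1) j" if "k \<in> {..<Suc m2}" for k j
    using row1[of k j] that v\<rho> by (cases "m2 - k = \<rho>") (auto simp: a_def)
  have row2': "b k * row (m1 + m2 + 1 - k) (Suc j) = b k * coeff (?D k h2) j" if "k \<in> {..<Suc m1}" for k j
    using row2[of k j] that v\<rho> by (cases "m1 + m2 + 1 - k = \<rho>") (auto simp: b_def)
  (* Read off coefficient j of the operators from column Suc j. The coefficients above m1 + m2 have
     no column, but vanish by reason of degree. *)
  have comb: "(\<Sum>k<Suc m2. smult (a k) (?D k h1)) + (\<Sum>k<Suc m1. smult (b k) (?D k h2)) = 0"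
  proof (rule poly_eqI)
    fix j
    show "coeff ((\<Sum>k<Suc m2. smult (a k) (?D k h1)) + (\<Sum>k<Suc m1. smult (b k) (?D k h2))) j = coeff 0 j"
    proof (cases "j \<le> m1 + m2")
      case True
      have "0 = (\<Sum>r<?n. v $ r * row r (Suc j))" using rel[of "Suc j"] True by simp
      also have "\<dots> = (\<Sum>k<Suc m2. a k * row (m2 - k) (Suc j)) + (\<Sum>k<Suc m1. b k * row (m1 + m2 + 1 - k) (Suc j))"
        by (simp only: sum_two_blocks a_def b_def)
      also have "(\<Sum>k<Suc m2. a k * row (m2 - k) (Suc j)) = (\<Sum>k<Suc m2. a k * coeff (?D k h1) j)"
        by (intro sum.cong refl) (rule row1')
      also have "(\<Sum>k<Suc m1. b k * row (m1 + m2 + 1 - k) (Suc j)) = (\<Sum>k<Suc m1. b k * coeff (?D k h2) j)"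
        by (intro sum.cong refl) (rule row2')
      finally show ?thesis by (simp add: coeff_sum)
    next
      case False
      then show ?thesis
        using degree_deriv_comp_funpow(1)[OF d h(1)] degree_deriv_comp_funpow(1)[OF d h(2)]
        by (simp add: coeff_sum coeff_eq_0 m1_def m2_def)
    qed
  qed
  have "(\<forall>k<Suc m2. a k = 0) \<and> (\<forall>k<Suc m1. b k = 0)"
    using \<rho>
  proof
    assume "\<rho> = 0"
    then have am: "a m2 = 0" using v\<rho> by (simp add: a_def)
    then have "(\<Sum>k<degree h2. smult (a k) (?D k h1)) + (\<Sum>k<Suc m1. smult (b k) (?D k h2)) = 0"
      using comb by (simp add: m2_def)
    from no_relation_of_low_order[OF d one h(2) this] am show ?thesis
      by (auto simp: m2_def less_Suc_eq)
  next
    assume "\<rho> = Suc m2"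
    then have bm: "b m1 = 0" using v\<rho> by (simp add: b_def)
    then have "(\<Sum>k<degree h1. smult (b k) (?D k h2)) + (\<Sum>k<Suc m2. smult (a k) (?D k h1)) = 0"
      using comb by (simp add: m1_def add.commute)
    from no_relation_of_low_order[OF d _ h(1) this] one bm show ?thesis
      by (auto simp: m1_def less_Suc_eq insert_commute)
  qed
  then have ab: "a k = 0" if "k \<le> m2" for k using that by simp
  have b: "b k = 0" if "k \<le> m1" for k using that \<open>_ \<and> _\<close> by simp
  have "v $ r = 0" if "r < ?n" for r
  proof (cases "r \<le> m2")
    case True
    then show ?thesis using ab[of "m2 - r"] by (simp add: a_def)
  next
    case False
    then have "m1 + m2 + 1 - (m1 + m2 + 1 - r) = r" "m1 + m2 + 1 - r \<le> m1" using that by auto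
    then show ?thesis using b[of "m1 + m2 + 1 - r"] by (simp add: b_def)
  qed
  then have "v = 0\<^sub>v ?n" using v(1) by (intro eq_vecI) auto
  with v(2) show False by simp
qed

section \<open>Specialization at the parametrized point\<close>

lemma deval_nonzero: "diff_transcendental \<iota> dE u \<Longrightarrow> f \<noteq> 0 \<Longrightarrow> deval \<iota> dE u f \<noteq> 0"
  by (auto simp: diff_transcendental_def)

text \<open>
  The linear part of the equation \<open>w Q - P\<close> at \<open>w = P(u)/Q(u)\<close>.
\<close>

definition equation_operator ::
  "('f::field \<Rightarrow> 'e::field) \<Rightarrow> ('e \<Rightarrow> 'e) \<Rightarrow> 'e \<Rightarrow> (unit, 'f) dpoly \<Rightarrow> (unit, 'f) dpoly \<Rightarrow> 'e poly" where
  "equation_operator \<iota> dE u P Q =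
     smult (rat_val \<iota> dE u P Q) (linearization \<iota> dE u Q) - linearization \<iota> dE u P"

text \<open>
  The point \<open>(1, u, u', u'', \<dots>)\<close>, at which coefficient vectors of affine forms are evaluated.
\<close>

definition affine_point :: "('e::one \<Rightarrow> 'e) \<Rightarrow> 'e \<Rightarrow> nat \<Rightarrow> 'e" where
  "affine_point dE u i = (case i of 0 \<Rightarrow> 1 | Suc j \<Rightarrow> (dE ^^ j) u)"

definition specialized_row ::
  "('f::field \<Rightarrow> 'e::field) \<Rightarrow> ('f \<Rightarrow> 'f) \<Rightarrow> (xy \<Rightarrow> nat \<Rightarrow> 'e) \<Rightarrow> xy \<Rightarrow>
   (unit, 'f) dpoly \<Rightarrow> (unit, 'f) dpoly \<Rightarrow> nat \<Rightarrow> nat \<Rightarrow> 'e" where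
  "specialized_row \<iota> dF s w P Q k i =
     dpoly_eval \<iota> s (affine_coeff ((dpoly_deriv (dpoly_deriv dF) ^^ k) (implicit_eq w P Q)) i)"

context
  fixes \<iota> :: "'f::field \<Rightarrow> 'e::field" and dF :: "'f \<Rightarrow> 'f" and dE :: "'e \<Rightarrow> 'e" and u :: 'e
    and P Q :: "(unit, 'f) dpoly" and m :: nat
  assumes ext: "differential_extension \<iota> dF dE" and trans: "diff_transcendental \<iota> dE u"
    and red: "linear_reduced P Q" and ord: "rat_ord P Q = Fin m"
begin

interpretation \<iota>: field_hom \<iota>
  using ext by (simp add: differential_extension_def)

interpretation deval: comm_ring_hom "deval \<iota> dE u"
  unfolding deval_eq_dpoly_eval by (rule comm_ring_hom_dpoly_eval) (rule embedding_hom[OF ext])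

lemma reduced_total_degree: "total_degree P \<le> 1" "total_degree Q \<le> 1" and deval_denominator_nonzero: "deval \<iota> dE u Q \<noteq> 0"
  using red deval_nonzero[OF trans] by (auto simp: linear_reduced_def)

text \<open>
  If \<open>P(u)/Q(u) = c\<close> is constant, then \<open>P = c Q\<close>, so \<open>Q\<close> divides the trivial gcd.  But a unit contains no
  derivative of \<open>u\<close>, and then the order of \<open>P / Q\<close> would be \<open>-\<infinity>\<close>.
\<close>

lemma rat_val_notin_base: "rat_val \<iota> dE u P Q \<notin> range \<iota>"
proof
  assume "rat_val \<iota> dE u P Q \<in> range \<iota>"
  then obtain c where "rat_val \<iota> dE u P Q = \<iota> c" by blast
  then have "deval \<iota> dE u (P - dconst c * Q) = 0"
    using deval_denominator_nonzero by (simp add: rat_val_def deval.hom_minus deval.hom_mult deval_dconst[OF ext] field_simps)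
  then have P: "P = dconst c * Q" using trans unfolding diff_transcendental_def by auto
  have "\<not> occurs () k Q" for k
    using red P by (intro affine_unit_const) (auto simp: linear_reduced_def gcd_is_one_def)
  moreover have "occurs () m Q"
    using rat_ord_eq_FinD(1)[OF ord] unfolding P by (auto simp: occurs_def in_keys_iff lookup_dconst_mult)
  ultimately show False by blast
qed

lemma coeff_equation_operator:
  "coeff (equation_operator \<iota> dE u P Q) j =
     rat_val \<iota> dE u P Q * \<iota> (affine_coeff Q (Suc j)) - \<iota> (affine_coeff P (Suc j))"
  by (simp add: equation_operator_def coeff_linearization_affine[OF ext reduced_total_degree(1)]
      coeff_linearization_affine[OF ext reduced_total_degree(2)])

text \<open>
  The coefficient \<open>x0 q - p\<close>, with \<open>p\<close> and \<open>q\<close> in \<open>F\<close>, vanishes only for \<open>p = q = 0\<close>, because \<open>x0\<close> is not in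
  \<open>F\<close>.  So nothing cancels and the order of \<open>P / Q\<close> is the order of the operator.
\<close>

lemma degree_equation_operator:
  "degree (equation_operator \<iota> dE u P Q) = m" "equation_operator \<iota> dE u P Q \<noteq> 0"
proof -
  let ?h = "equation_operator \<iota> dE u P Q"
  have eq0: "x * \<iota> b - \<iota> a = 0 \<longleftrightarrow> a = 0 \<and> b = 0" if "x \<notin> range \<iota>" for x a b
  proof
    assume eq: "x * \<iota> b - \<iota> a = 0"
    have "b = 0"
    proof (rule ccontr)
      assume "b \<noteq> 0"
      then have "x = \<iota> a * inverse (\<iota> b)" using eq by (simp add: field_simps)
      then have "x = \<iota> (a * inverse b)" by (simp add: \<iota>.hom_mult \<iota>.hom_inverse)
      with that show False by blast
    qed
    with eq show "a = 0 \<and> b = 0" by simp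
  qed simp
  have "affine_coeff P (Suc m) \<noteq> 0 \<or> affine_coeff Q (Suc m) \<noteq> 0"
    using rat_ord_eq_FinD(1)[OF ord]
    by (simp only: occurs_iff_affine_coeff[OF reduced_total_degree(1)] occurs_iff_affine_coeff[OF reduced_total_degree(2)])
  then have top: "coeff ?h m \<noteq> 0"
    by (simp only: coeff_equation_operator eq0[OF rat_val_notin_base]) blast
  have "degree ?h \<le> m"
    by (rule degree_le) (simp add: coeff_equation_operator affine_coeff_eq_0_above_order[OF reduced_total_degree ord])
  then show "degree ?h = m" using le_degree[OF top] by simp
  show "?h \<noteq> 0" using top by auto
qed

lemma sum_affine_coeff_affine_point:
  assumes f: "total_degree f \<le> 1" "\<And>i. Suc m < i \<Longrightarrow> affine_coeff f i = 0" and n: "m + 2 \<le> n"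
  shows "(\<Sum>i<n. \<iota> (affine_coeff f i) * affine_point dE u i) = deval \<iota> dE u f"
proof -
  obtain n' where n': "n = Suc n'" "Suc m \<le> n'" using n by (cases n) auto
  have "deval \<iota> dE u f = \<iota> (affine_coeff f 0) + (\<Sum>k<n'. \<iota> (affine_coeff f (Suc k)) * (dE ^^ k) u)"
    by (rule deval_affine[OF ext f(1)]) (use f(2) n' in auto)
  then show ?thesis by (simp add: n' affine_point_def sum.lessThan_Suc_shift del: sum.lessThan_Suc)
qed

lemma quot_linearization_eq:
  "quot_linearization \<iota> dE u P Q = smult (- deval \<iota> dE u Q) (equation_operator \<iota> dE u P Q)"
  using deval_denominator_nonzero by (simp add: quot_linearization_def equation_operator_def rat_val_def smult_diff_right)

context
  fixes s :: "xy \<Rightarrow> nat \<Rightarrow> 'e" and w :: xy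
  assumes s0: "s w 0 = rat_val \<iota> dE u P Q" and s_Suc: "\<And>w k. s w (Suc k) = dE (s w k)"
begin

interpretation ev: comm_ring_hom "dpoly_eval \<iota> s"
  by (rule comm_ring_hom_dpoly_eval[OF embedding_hom[OF ext]])

lemma specialized_row_0:
  "specialized_row \<iota> dF s w P Q 0 i = rat_val \<iota> dE u P Q * \<iota> (affine_coeff Q i) - \<iota> (affine_coeff P i)"
  by (simp add: specialized_row_def affine_coeff_def lookup_implicit_eq ev.hom_minus ev.hom_mult s0
      dpoly_eval_dconst[OF embedding_hom[OF ext]] dpoly_eval_dvar[OF embedding_hom[OF ext]])

lemma specialized_row_step:
  "specialized_row \<iota> dF s w P Q (Suc k) i = dE (specialized_row \<iota> dF s w P Q k i) +
     (case i of Suc (Suc j) \<Rightarrow> specialized_row \<iota> dF s w P Q k (Suc j) | _ \<Rightarrow> 0)"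
proof -
  have "dpoly_eval \<iota> s (dpoly_deriv dF f) = dE (dpoly_eval \<iota> s f)" for f
    by (intro dpoly_eval_deriv embedding_hom[OF ext] derivation_dF[OF ext] derivation_dE[OF ext]
      embedding_deriv[OF ext] s_Suc)
  then show ?thesis
    by (simp add: specialized_row_def affine_coeff_deriv[OF derivation_dpoly_deriv[OF derivation_dF[OF ext]]]
      ev.hom_add split: nat.split)
qed

lemma specialized_row_Suc:
  "specialized_row \<iota> dF s w P Q k (Suc j) = coeff ((deriv_comp dE ^^ k) (equation_operator \<iota> dE u P Q)) j"
  by (induction k arbitrary: j)
     (simp_all add: specialized_row_0 coeff_equation_operator specialized_row_step
       coeff_deriv_comp[OF derivation_dE[OF ext]] split: nat.split)

lemma specialized_row_eq_0: "m + k + 2 \<le> i \<Longrightarrow> specialized_row \<iota> dF s w P Q k i = 0"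
  using degree_deriv_comp_funpow(1)[OF derivation_dE[OF ext] degree_equation_operator(2)]
  by (cases i) (simp_all add: specialized_row_Suc coeff_eq_0 degree_equation_operator)

text \<open>
  The equation holds at \<open>u\<close>, and so do its derivatives.  The bound on \<open>n\<close> makes the sum run over all
  nonzero coefficients of the row.
\<close>

lemma specialized_row_vanishes:
  assumes "m + k + 2 \<le> n"
  shows "(\<Sum>i<n. specialized_row \<iota> dF s w P Q k i * affine_point dE u i) = 0"
proof -
  let ?U = "affine_point dE u"
  have d: "derivation dE" by (rule derivation_dE[OF ext])
  have "dE 1 = 0" using d unfolding derivation_def by (metis add_cancel_right_right mult_1_left mult_1_right)
  then have dU: "dE (?U i) = (case i of 0 \<Rightarrow> 0 | Suc j \<Rightarrow> ?U (Suc i))" for i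
    by (simp add: affine_point_def split: nat.split)
  have d_sum: "dE (\<Sum>i<l. g i * ?U i) = (\<Sum>i<l. dE (g i) * ?U i) + (\<Sum>i<l. g i * dE (?U i))" for l g
    using d by (induction l) (simp_all add: derivation_zero derivation_def)
  have "(\<Sum>i<m + k + 2. specialized_row \<iota> dF s w P Q k i * ?U i) = 0"
  proof (induction k)
    case 0
    have "(\<Sum>i<m + 2. specialized_row \<iota> dF s w P Q 0 i * ?U i) =
        rat_val \<iota> dE u P Q * (\<Sum>i<m + 2. \<iota> (affine_coeff Q i) * ?U i) - (\<Sum>i<m + 2. \<iota> (affine_coeff P i) * ?U i)"
      by (simp only: specialized_row_0 left_diff_distrib sum_subtractf sum_distrib_left mult.assoc)
    also have "\<dots> = rat_val \<iota> dE u P Q * deval \<iota> dE u Q - deval \<iota> dE u P"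
      using affine_coeff_eq_0_above_order[OF reduced_total_degree ord] by (simp only: sum_affine_coeff_affine_point reduced_total_degree order_refl)
    finally show ?case using deval_denominator_nonzero by (simp add: rat_val_def)
  next
    case (Suc k)
    let ?l = "m + k + 2"
    have l: "m + Suc k + 2 = Suc ?l" by simp
    have "(\<Sum>i<Suc ?l. (case i of Suc (Suc j) \<Rightarrow> specialized_row \<iota> dF s w P Q k (Suc j) | _ \<Rightarrow> 0) * ?U i) =
        (\<Sum>i<?l. specialized_row \<iota> dF s w P Q k i * dE (?U i))"
    proof -
      have "(case Suc i of Suc (Suc j) \<Rightarrow> specialized_row \<iota> dF s w P Q k (Suc j) | _ \<Rightarrow> 0) * ?U (Suc i) =
          specialized_row \<iota> dF s w P Q k i * dE (?U i)" for i
        by (cases i) (simp_all add: dU)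
      then show ?thesis by (simp only: sum.lessThan_Suc_shift) simp
    qed
    moreover have "(\<Sum>i<Suc ?l. dE (specialized_row \<iota> dF s w P Q k i) * ?U i) = (\<Sum>i<?l. dE (specialized_row \<iota> dF s w P Q k i) * ?U i)"
      by (simp only: sum.lessThan_Suc specialized_row_eq_0 order_refl derivation_zero[OF d] mult_zero_left add_0_right)
    ultimately have "(\<Sum>i<Suc ?l. specialized_row \<iota> dF s w P Q (Suc k) i * ?U i) = dE (\<Sum>i<?l. specialized_row \<iota> dF s w P Q k i * ?U i)"
      by (simp only: specialized_row_step distrib_right sum.distrib d_sum)
    then show ?case by (simp only: l Suc.IH derivation_zero[OF d])
  qed
  moreover have "(\<Sum>i<n. specialized_row \<iota> dF s w P Q k i * ?U i) = (\<Sum>i<m + k + 2. specialized_row \<iota> dF s w P Q k i * ?U i)"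
    by (rule sum.mono_neutral_right) (use assms in \<open>auto simp: specialized_row_eq_0\<close>)
  ultimately show ?thesis by simp
qed

end

end

section \<open>The implicit equation\<close>

theorem theorem4p5:
  fixes \<iota> :: "'f::field_char_0 \<Rightarrow> 'e::field_char_0"
    and dF :: "'f \<Rightarrow> 'f" and dE :: "'e \<Rightarrow> 'e" and u :: 'e
    and P1 Q1 P2 Q2 :: "(unit, 'f) dpoly"
    and m1 m2 :: nat
    and R :: "(xy, 'f) dpoly"
  assumes "universal_extension \<iota> dF dE"
    and "diff_transcendental \<iota> dE u"
    and "linear_param \<iota> dE u P1 Q1 P2 Q2"
    and "rat_ord P1 Q1 = Fin m1"
    and "rat_ord P2 Q2 = Fin m2"
    and "proper_param \<iota> dE u P1 Q1 P2 Q2"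
  defines "R \<equiv> dres (dpoly_deriv dF) (implicit_eq X P1 Q1) (implicit_eq Y P2 Q2)"
  shows "R \<noteq> 0 \<and> dord X R = Fin m2 \<and> dord Y R = Fin m1 \<and>
         degree_in X m2 R = 1 \<and> degree_in Y m1 R = 1"
proof -
  note trans = assms(2) and ord = assms(4,5)
  have ext: "differential_extension \<iota> dF dE"
    using assms(1) by (simp add: universal_extension_def)
  have red: "linear_reduced P1 Q1" "linear_reduced P2 Q2"
    using assms(3) by (simp_all add: linear_param_def)
  note param1 = ext trans red(1) ord(1) and param2 = ext trans red(2) ord(2)
  note dF = derivation_dF[OF ext] and dE = derivation_dE[OF ext]
  define h1 where "h1 = equation_operator \<iota> dE u P1 Q1"
  define h2 where "h2 = equation_operator \<iota> dE u P2 Q2"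
  have deg: "m1 = degree h1" "m2 = degree h2" and nz: "h1 \<noteq> 0" "h2 \<noteq> 0"
    using degree_equation_operator[OF param1] degree_equation_operator[OF param2]
    by (simp_all add: h1_def h2_def)

  have "u \<in> diff_field_gen \<iota> dE {u}" by (auto simp: diff_field_gen_def)
  then have "u \<in> diff_field_gen \<iota> dE {rat_val \<iota> dE u P1 Q1, rat_val \<iota> dE u P2 Q2}"
    using assms(6) by (simp add: proper_param_def)
  then have one: "1 \<in> left_ideal_gen dE {h1, h2}"
    by (rule one_in_left_ideal_gen[OF ext trans deval_denominator_nonzero[OF param1] deval_denominator_nonzero[OF param2], rotated 2])
       (unfold quot_linearization_eq[OF param1] quot_linearization_eq[OF param2] h1_def h2_def,
         (intro left_ideal_gen.smult left_ideal_gen.gen insertI1 insertI2)+)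

  let ?N = "m1 + m2 + 1" and ?n = "m1 + m2 + 2"
  define s where "s w k = (dE ^^ k) (case w of X \<Rightarrow> rat_val \<iota> dE u P1 Q1 | Y \<Rightarrow> rat_val \<iota> dE u P2 Q2)" for w k
  have s: "s X 0 = rat_val \<iota> dE u P1 Q1" "s Y 0 = rat_val \<iota> dE u P2 Q2" "s w (Suc k) = dE (s w k)" for w k
    by (simp_all add: s_def)
  interpret ev: comm_ring_hom "dpoly_eval \<iota> s"
    by (rule comm_ring_hom_dpoly_eval[OF embedding_hom[OF ext]])
  let ?row1 = "\<lambda>k. affine_coeff ((dpoly_deriv (dpoly_deriv dF) ^^ k) (implicit_eq X P1 Q1))"
  let ?row2 = "\<lambda>k. affine_coeff ((dpoly_deriv (dpoly_deriv dF) ^^ k) (implicit_eq Y P2 Q2))"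
  define row where "row r = (if r \<le> m2 then ?row1 (m2 - r) else ?row2 (?N - r))" for r
  define A where "A = mat ?n ?n (\<lambda>(r, c). row r (?N - c))"
  have R: "R = det A"
    unfolding R_def dres_def A_def row_def
      dres_matrix_altdef[OF nat_ord_implicit_eq[OF ord(1)] nat_ord_implicit_eq[OF ord(2)]]
    by (intro arg_cong[of _ _ det] cong_mat refl) auto
  have A: "A \<in> carrier_mat ?n ?n" by (simp add: A_def)

  have sumQ: "(\<Sum>i<?n. \<iota> (affine_coeff Q1 i) * affine_point dE u i) = deval \<iota> dE u Q1"
    "(\<Sum>i<?n. \<iota> (affine_coeff Q2 i) * affine_point dE u i) = deval \<iota> dE u Q2"
    using affine_coeff_eq_0_above_order(2)[OF reduced_total_degree[OF param1] ord(1)]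
      affine_coeff_eq_0_above_order(2)[OF reduced_total_degree[OF param2] ord(2)]
    by (intro sum_affine_coeff_affine_point[OF param1 reduced_total_degree(2)[OF param1]]
          sum_affine_coeff_affine_point[OF param2 reduced_total_degree(2)[OF param2]]; simp)+

  (* The leading coefficients of R in both highest derivatives, treated together: row 0 belongs to
     x^(m2), row Suc m2 to y^(m1). *)
  have minor: "det (replace_row \<rho> (\<lambda>c. dconst (affine_coeff Q (?N - c))) A) \<noteq> 0"
    if \<rho>: "\<rho> = 0 \<and> Q = Q1 \<or> \<rho> = Suc m2 \<and> Q = Q2" for \<rho> Q
  proof -
    define erow where "erow r i = (if r = \<rho> then \<iota> (affine_coeff Q i) else dpoly_eval \<iota> s (row r i))" for r i
    have "det (mat ?n ?n (\<lambda>(r, c). erow r (?N - c))) \<noteq> 0"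
    proof (rule det_augmented_nonzero[OF deg dE one nz])
      show "\<rho> = 0 \<or> \<rho> = Suc m2" using \<rho> by blast
      show "erow (m2 - k) (Suc j) = coeff ((deriv_comp dE ^^ k) h1) j" if "k \<le> m2" "m2 - k \<noteq> \<rho>" for k j
        using that specialized_row_Suc[where s = s and w = X, OF param1 s(1,3)]
        by (simp add: erow_def row_def h1_def specialized_row_def)
      show "erow (?N - k) (Suc j) = coeff ((deriv_comp dE ^^ k) h2) j" if "k \<le> m1" "?N - k \<noteq> \<rho>" for k j
      proof -
        have "\<not> ?N - k \<le> m2" "?N - (?N - k) = k" using that(1) by auto
        then have "row (?N - k) = ?row2 k" by (simp only: row_def if_False)
        then show ?thesis
          using that(2) specialized_row_Suc[where s = s and w = Y, OF param2 s(2,3)]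
          by (simp add: erow_def h2_def specialized_row_def)
      qed
      show "(\<Sum>i<?n. erow r i * affine_point dE u i) = 0" if "r < ?n" "r \<noteq> \<rho>" for r
        using that specialized_row_vanishes[where s = s and w = X, OF param1 s(1,3), where k = "m2 - r" and n = ?n]
          specialized_row_vanishes[where s = s and w = Y, OF param2 s(2,3), where k = "?N - r" and n = ?n]
        by (simp add: erow_def row_def specialized_row_def
            del: sum.lessThan_Suc)
      show "(\<Sum>i<?n. erow \<rho> i * affine_point dE u i) \<noteq> 0"
      proof -
        have "(\<Sum>i<?n. erow \<rho> i * affine_point dE u i) = (\<Sum>i<?n. \<iota> (affine_coeff Q i) * affine_point dE u i)"
          by (simp only: erow_def refl if_True)
        also have "\<dots> = deval \<iota> dE u Q"
          using \<rho> sumQ by blast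
        finally show ?thesis
          using \<rho> deval_denominator_nonzero[OF param1] deval_denominator_nonzero[OF param2] by auto
      qed
    qed
    also have "mat ?n ?n (\<lambda>(r, c). erow r (?N - c)) =
        map_mat (dpoly_eval \<iota> s) (replace_row \<rho> (\<lambda>c. dconst (affine_coeff Q (?N - c))) A)"
      by (intro eq_matI) (auto simp: replace_row_def A_def erow_def dpoly_eval_dconst[OF embedding_hom[OF ext]])
    finally show ?thesis by (auto simp: ev.hom_det)
  qed
  have entry: "A $$ (r, c) = row r (?N - c)" if "r < ?n" "c < ?n" for r c
    using that by (simp add: A_def)
  have X: "dpoly_over ({X} \<times> {..<m2}) \<subseteq> dpoly_over {(i, j). i = X \<longrightarrow> j < m2}"
    "k < m2 \<Longrightarrow> dpoly_over ({X} \<times> {..k}) \<subseteq> dpoly_over {(i, j). i = X \<longrightarrow> j < m2}"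
    "dpoly_over ({Y} \<times> {..k}) \<subseteq> dpoly_over {(i, j). i = X \<longrightarrow> j < m2}" for k
    by (rule dpoly_over_mono; auto)+
  have Y: "dpoly_over ({Y} \<times> {..<m1}) \<subseteq> dpoly_over {(i, j). i = Y \<longrightarrow> j < m1}"
    "k < m1 \<Longrightarrow> dpoly_over ({Y} \<times> {..k}) \<subseteq> dpoly_over {(i, j). i = Y \<longrightarrow> j < m1}"
    "dpoly_over ({X} \<times> {..k}) \<subseteq> dpoly_over {(i, j). i = Y \<longrightarrow> j < m1}" for k
    by (rule dpoly_over_mono; auto)+
  note over = implicit_row_over[OF dF] and form = implicit_row_form[OF dF]

  have rowX: "A $$ (0, c) - dvar X m2 * dconst (affine_coeff Q1 (?N - c)) \<in> dpoly_over {(i, j). i = X \<longrightarrow> j < m2}"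
    if "c < ?n" for c
    using subsetD[OF X(1) form] that by (simp add: entry row_def)
  have othersX: "A $$ (r, c) \<in> dpoly_over {(i, j). i = X \<longrightarrow> j < m2}" if "r < ?n" "c < ?n" "r \<noteq> 0" for r c
    using that subsetD[OF X(2) over] subsetD[OF X(3) over] by (auto simp: entry row_def)
  have rowY: "A $$ (Suc m2, c) - dvar Y m1 * dconst (affine_coeff Q2 (?N - c)) \<in> dpoly_over {(i, j). i = Y \<longrightarrow> j < m1}"
    if "c < ?n" for c
    using subsetD[OF Y(1) form] that by (simp add: entry row_def)
  have othersY: "A $$ (r, c) \<in> dpoly_over {(i, j). i = Y \<longrightarrow> j < m1}" if "r < ?n" "c < ?n" "r \<noteq> Suc m2" for r c
    using that subsetD[OF Y(2) over] subsetD[OF Y(3) over] by (auto simp: entry row_def)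
  note in_X = det_affine_in_variable[OF A _ rowX dpoly_over_dconst othersX minor]
  note in_Y = det_affine_in_variable[OF A _ rowY dpoly_over_dconst othersY minor]
  show ?thesis
    unfolding R by (intro conjI in_X in_Y) simp_all
qed

end
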